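(* Let $0\le\epsilon\le 1/2$. For every string $S$ of length $n$ whose maximum character frequency is $m$, there exists a data structure of ${\rm O}(n^{1+\epsilon}\log n+n^{2-\epsilon})$ bits, in addition to $S$, that answers range mode enumeration queries. A query range $[l,r]$ with $0\le l\le r<n$ is answered in ${\rm O}(\log m+n^{1-\epsilon}+|output|)$ time.
   Context: $S=S[0..n-1]$ is a string over an alphabet $\Sigma$. There is a bijection $\Sigma\to\{0,\dots,|\Sigma|-1\}$ computable in constant time. A mode of a non-empty multiset is an element whose multiplicity is at least that of every other element. The range mode enumeration query for $[l,r]$ asks for all distinct characters that are modes of the multiset $\{S[l],\dots,S[r]\}$. $|output|$ is the number of such characters. $m$ is the largest number of occurrences of any character in $S$. Space is counted in bits and excludes the input string $S$, which may be accessed during queries. *)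

theory Defs
  imports Complex_Main "HOL-Library.Multiset"
begin

section \<open>Modes\<close>

definition is_mode :: "'a multiset \<Rightarrow> 'a \<Rightarrow> bool" where
  "is_mode A x \<longleftrightarrow> x \<in># A \<and> (\<forall>y. y \<in># A \<longrightarrow> count A y \<le> count A x)"

definition range_mset :: "'a list \<Rightarrow> nat \<Rightarrow> nat \<Rightarrow> 'a multiset" where
  "range_mset S l r = image_mset (\<lambda>i. S ! i) (mset_set {l..r})"

definition range_modes :: "'a list \<Rightarrow> nat \<Rightarrow> nat \<Rightarrow> 'a set" where
  "range_modes S l r = {x. is_mode (range_mset S l r) x}"

text \<open>Only meaningful for a non-empty string.\<close>

definition max_freq :: "'a list \<Rightarrow> nat" where
  "max_freq S = Max (count (mset S) ` set S)"


section \<open>Word RAM\<close>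

text \<open>
  A unit-cost RAM whose words are the naturals below \<open>2 ^ w\<close>. It has two read-only inputs: the
  string \<open>T\<close> of character codes, one character per access, and the data structure \<open>D\<close>, a bit
  string from which up to \<open>w\<close> consecutive bits, starting at any bit position, can be read in one
  step (on a word-aligned memory this takes two accesses and a constant number of shifts).
  A program uses finitely many registers and a random access working memory.
  Programs are structured; every instruction and every test of a register costs one time unit.
\<close>

type_synonym reg = nat

datatype operator =
    Add | Sub | Mul | Div | Mod
  | And | Or | Xor | Shl | Shr
  | Less | Equal

fun apply_op :: "nat \<Rightarrow> operator \<Rightarrow> nat \<Rightarrow> nat \<Rightarrow> nat" where
  "apply_op w Add a b = (a + b) mod 2 ^ w"
| "apply_op w Sub a b = (a + 2 ^ w - b) mod 2 ^ w"
| "apply_op w Mul a b = (a * b) mod 2 ^ w"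
| "apply_op w Div a b = (a div b) mod 2 ^ w"
| "apply_op w Mod a b = (a mod b) mod 2 ^ w"
| "apply_op w And a b = Bit_Operations.and a b mod 2 ^ w"
| "apply_op w Or a b = Bit_Operations.or a b mod 2 ^ w"
| "apply_op w Xor a b = Bit_Operations.xor a b mod 2 ^ w"
| "apply_op w Shl a b = push_bit b a mod 2 ^ w"
| "apply_op w Shr a b = drop_bit b a mod 2 ^ w"
| "apply_op w Less a b = of_bool (a < b) mod 2 ^ w"
| "apply_op w Equal a b = of_bool (a = b) mod 2 ^ w"

datatype instr =
    Const reg nat
  | Arith operator reg reg reg
  | Load reg reg
  | Store reg reg
  | ReadChar reg reg
  | ReadBits reg reg reg
  | Emit reg

datatype com =
    Do instr
  | Seq com com
  | If reg com com
  | While reg com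

record state =
  regs :: "reg \<Rightarrow> nat"
  mem :: "nat \<Rightarrow> nat"
  emitted :: "nat list"

definition set_reg :: "reg \<Rightarrow> nat \<Rightarrow> state \<Rightarrow> state" where
  "set_reg x v s = s\<lparr>regs := (regs s)(x := v)\<rparr>"

text \<open>The \<open>k\<close> bits of \<open>D\<close> from position \<open>a\<close> on, least significant bit first.\<close>

definition bit_field :: "bool list \<Rightarrow> nat \<Rightarrow> nat \<Rightarrow> nat" where
  "bit_field D a k = horner_sum of_bool 2 (take k (drop a D))"

text \<open>\<open>None\<close>: the machine is stuck on an access outside \<open>T\<close> or \<open>D\<close>.\<close>

fun step :: "nat \<Rightarrow> nat list \<Rightarrow> bool list \<Rightarrow> instr \<Rightarrow> state \<Rightarrow> state option" where
  "step w T D (Const x c) s = Some (set_reg x (c mod 2 ^ w) s)"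
| "step w T D (Arith f x y z) s = Some (set_reg x (apply_op w f (regs s y) (regs s z)) s)"
| "step w T D (Load x y) s = Some (set_reg x (mem s (regs s y)) s)"
| "step w T D (Store x y) s = Some (s\<lparr>mem := (mem s)(regs s x := regs s y)\<rparr>)"
| "step w T D (ReadChar x y) s =
    (if regs s y < length T then Some (set_reg x (T ! regs s y) s) else None)"
| "step w T D (ReadBits x y z) s =
    (if regs s z \<le> w \<and> regs s y + regs s z \<le> length D
     then Some (set_reg x (bit_field D (regs s y) (regs s z)) s) else None)"
| "step w T D (Emit x) s = Some (s\<lparr>emitted := emitted s @ [regs s x]\<rparr>)"

text \<open>\<open>exec w T D P s t s'\<close>: started in \<open>s\<close>, program \<open>P\<close> halts in \<open>s'\<close> after \<open>t\<close> time units.\<close>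

inductive exec :: "nat \<Rightarrow> nat list \<Rightarrow> bool list \<Rightarrow> com \<Rightarrow> state \<Rightarrow> nat \<Rightarrow> state \<Rightarrow> bool"
  for w :: nat and T :: "nat list" and D :: "bool list" where
  Do: "step w T D i s = Some s' \<Longrightarrow> exec w T D (Do i) s 1 s'"
| Seq: "exec w T D P s t s' \<Longrightarrow> exec w T D Q s' t' s'' \<Longrightarrow> exec w T D (Seq P Q) s (t + t') s''"
| IfTrue: "regs s x \<noteq> 0 \<Longrightarrow> exec w T D P s t s' \<Longrightarrow> exec w T D (If x P Q) s (t + 1) s'"
| IfFalse: "regs s x = 0 \<Longrightarrow> exec w T D Q s t s' \<Longrightarrow> exec w T D (If x P Q) s (t + 1) s'"
| WhileFalse: "regs s x = 0 \<Longrightarrow> exec w T D (While x P) s 1 s"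
| WhileTrue: "regs s x \<noteq> 0 \<Longrightarrow> exec w T D P s t s' \<Longrightarrow> exec w T D (While x P) s' t' s'' \<Longrightarrow>
    exec w T D (While x P) s (t + t' + 1) s''"

definition query_state :: "nat \<Rightarrow> nat \<Rightarrow> (nat \<Rightarrow> nat) \<Rightarrow> state" where
  "query_state l r M = \<lparr>regs = (\<lambda>_. 0)(0 := l, 1 := r), mem = M, emitted = []\<rparr>"

text \<open>
  On query \<open>[l, r]\<close> the program enumerates \<open>X\<close>, each element once, in time at most \<open>b\<close>. The
  working memory is not initialised: its contents \<open>M\<close> are arbitrary words.
\<close>

definition enumerates_within ::
  "nat \<Rightarrow> nat list \<Rightarrow> bool list \<Rightarrow> com \<Rightarrow> nat \<Rightarrow> nat \<Rightarrow> nat set \<Rightarrow> real \<Rightarrow> bool" where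
  "enumerates_within w T D P l r X b \<longleftrightarrow>
     (\<forall>M. (\<forall>a. M a < 2 ^ w) \<longrightarrow>
       (\<exists>t s'. exec w T D P (query_state l r M) t s' \<and> real t \<le> b \<and>
               distinct (emitted s') \<and> set (emitted s') = X))"

end

theory Submission
  imports Defs "HOL-Library.Product_Lexorder"
begin

text \<open>
  Cut the positions into blocks of length \<open>s\<close>, about \<open>n powr (1 - \<epsilon>)\<close>. For each block boundary \<open>p\<close> and
  each position \<open>r\<close> the structure stores the mode frequency of \<open>[p, r]\<close> and a linked list of its
  modes. The lists of one boundary share their cells: link each position \<open>v\<close> to the previous one
  that is also the \<open>c\<close>-th occurrence of its character from \<open>p\<close> on, for the same \<open>c\<close>. This is \<open>O(n)\<close>
  words per boundary, thus \<open>O(n powr (1 + \<epsilon>))\<close> words in total.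

  For a query \<open>[l, r]\<close> let \<open>p\<close> be the first boundary after \<open>l\<close>. Only the at most \<open>s\<close> positions
  \<open>q < p\<close> are scanned. With the positions sorted by character, one lookup decides whether the
  character at \<open>q\<close> occurs more than \<open>f\<close> times in \<open>[q, r]\<close>. A first scan raises the mode frequency
  of \<open>[p, r]\<close> to that of \<open>[l, r]\<close>; a second one emits the modes whose first occurrence is before \<open>p\<close>. A mode
  without an occurrence there is a mode of \<open>[p, r]\<close> of the same frequency, so it is on the stored
  list; conversely, if the frequencies agree, then no character on that list occurs before \<open>p\<close>.
  The term \<open>log m\<close> of the time bound is absorbed, since \<open>\<epsilon> \<le> 1/2\<close> implies
  \<open>log n = O(n powr (1 - \<epsilon>))\<close>.
\<close>

section \<open>Modes and block boundaries\<close>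

definition occ :: "'a list \<Rightarrow> nat \<Rightarrow> nat \<Rightarrow> 'a \<Rightarrow> nat" where
  "occ T a b x = card {p \<in> {a..b}. T ! p = x}"

text \<open>The inserted 0 gives a value on empty ranges, which arise when a block boundary lies
  beyond \<open>r\<close>.\<close>

definition mode_freq :: "'a list \<Rightarrow> nat \<Rightarrow> nat \<Rightarrow> nat" where
  "mode_freq T a b = Max (insert 0 ((\<lambda>p. occ T a b (T ! p)) ` {a..b}))"

lemma count_range_mset: "count (range_mset T a b) x = occ T a b x"
proof -
  have "count (range_mset T a b) x = (\<Sum>y\<in>{p \<in> {a..b}. T ! p = x}. count (mset_set {a..b}) y)"
    unfolding range_mset_def count_image_mset by (intro sum.cong) auto
  also have "\<dots> = (\<Sum>y\<in>{p \<in> {a..b}. T ! p = x}. 1)"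
    by (intro sum.cong) auto
  finally show ?thesis by (simp add: occ_def)
qed

lemma occ_pos_iff: "0 < occ T a b x \<longleftrightarrow> (\<exists>p\<in>{a..b}. T ! p = x)"
  by (auto simp: occ_def card_gt_0_iff)

lemma mode_freq_le_iff: "mode_freq T a b \<le> c \<longleftrightarrow> (\<forall>x. occ T a b x \<le> c)"
proof -
  have "mode_freq T a b \<le> c \<longleftrightarrow> (\<forall>p\<in>{a..b}. occ T a b (T ! p) \<le> c)"
    by (simp add: mode_freq_def)
  also have "\<dots> \<longleftrightarrow> (\<forall>x. occ T a b x \<le> c)"
  proof -
    have "occ T a b x \<le> c" if "\<forall>p\<in>{a..b}. occ T a b (T ! p) \<le> c" for x
    proof (cases "occ T a b x = 0")
      case False
      then show ?thesis using that occ_pos_iff[of T a b x] by auto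
    qed simp
    then show ?thesis by blast
  qed
  finally show ?thesis .
qed

lemma occ_le_mode_freq: "occ T a b x \<le> mode_freq T a b"
  using mode_freq_le_iff[of T a b "mode_freq T a b"] by simp

lemma range_modes_eq:
  assumes "a \<le> b"
  shows "range_modes T a b = {x. occ T a b x = mode_freq T a b}"
proof -
  have pos: "0 < mode_freq T a b"
    using assms occ_pos_iff[of T a b "T ! a"] occ_le_mode_freq[of T a b "T ! a"] by force
  have "is_mode (range_mset T a b) x \<longleftrightarrow> 0 < occ T a b x \<and> (\<forall>y. occ T a b y \<le> occ T a b x)" for x
    unfolding is_mode_def count_range_mset[symmetric]
    by (metis count_greater_zero_iff gr0I le0)
  then have "is_mode (range_mset T a b) x \<longleftrightarrow> occ T a b x = mode_freq T a b" for x
    using pos occ_le_mode_freq[of T a b x] mode_freq_le_iff[of T a b "occ T a b x"] by fastforce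
  then show ?thesis
    by (simp add: range_modes_def)
qed

text \<open>The structure is built for the coded string. Injective coding preserves multiplicities,
  and a mode occurs at least once, so it lies where \<open>f\<close> is injective.\<close>

lemma range_modes_map:
  assumes inj: "inj_on f A" and sub: "set S \<subseteq> A" and le: "a \<le> b" and b: "b < length S"
  shows "range_modes (map f S) a b = f ` range_modes S a b"
proof -
  have mem: "p \<in> {a..b} \<Longrightarrow> S ! p \<in> A" for p
    using sub b by (auto intro!: subsetD[OF sub])
  have occ: "occ (map f S) a b (f x) = occ S a b x" if "x \<in> A" for x
  proof -
    have "map f S ! p = f x \<longleftrightarrow> S ! p = x" if "p \<in> {a..b}" for p
      using inj_on_eq_iff[OF inj mem[OF that] \<open>x \<in> A\<close>] that b by auto
    then show ?thesis
      unfolding occ_def by (intro arg_cong[where f = card] Collect_cong) blast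
  qed
  have mf: "mode_freq (map f S) a b = mode_freq S a b"
  proof -
    have "occ (map f S) a b (map f S ! p) = occ S a b (S ! p)" if "p \<in> {a..b}" for p
      using occ[OF mem[OF that]] that b by simp
    then show ?thesis
      unfolding mode_freq_def
      by (intro arg_cong[where f = Max] arg_cong[where f = "insert 0"] image_cong refl)
  qed
  have pos: "0 < mode_freq S a b"
    using le occ_pos_iff[of S a b "S ! a"] occ_le_mode_freq[of S a b "S ! a"] by force
  have 1: "x \<in> A" if "occ S a b x = mode_freq S a b" for x
    using that pos occ_pos_iff[of S a b x] mem by auto
  have 2: "y \<in> f ` A" if "occ (map f S) a b y = mode_freq S a b" for y
  proof -
    have "0 < occ (map f S) a b y"
      using that pos by simp
    then obtain p where "p \<in> {a..b}" "map f S ! p = y"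
      unfolding occ_pos_iff by blast
    then show ?thesis using mem[of p] b by auto
  qed
  show ?thesis
    unfolding range_modes_eq[OF le] mf
  proof (intro equalityI subsetI)
    fix y assume y: "y \<in> {x. occ (map f S) a b x = mode_freq S a b}"
    then obtain x where x: "x \<in> A" "y = f x"
      using 2[of y] by blast
    then show "y \<in> f ` {x. occ S a b x = mode_freq S a b}"
      using y occ[OF x(1)] by simp
  next
    fix y assume "y \<in> f ` {x. occ S a b x = mode_freq S a b}"
    then obtain x where x: "occ S a b x = mode_freq S a b" "y = f x"
      by blast
    then show "y \<in> {x. occ (map f S) a b x = mode_freq S a b}"
      using occ[OF 1] by simp
  qed
qed

section \<open>Splitting a range at a block boundary\<close>

lemma occ_split:
  assumes "a \<le> q" "q \<le> Suc b"
  shows "occ T a b x = card {p \<in> {a..<q}. T ! p = x} + occ T q b x"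
proof -
  have "{p \<in> {a..b}. T ! p = x} = {p \<in> {a..<q}. T ! p = x} \<union> {p \<in> {q..b}. T ! p = x}"
    using assms by auto
  then show ?thesis
    unfolding occ_def by (simp add: card_Un_disjoint disjoint_iff)
qed

lemma occ_mono: "a' \<le> a \<Longrightarrow> b \<le> b' \<Longrightarrow> occ T a b x \<le> occ T a' b' x"
  unfolding occ_def by (intro card_mono) auto

lemma occ_empty: "b < a \<Longrightarrow> occ T a b x = 0"
  by (simp add: occ_def)

lemma occ_less:
  assumes "a \<le> v" "u < v" "T ! v = x"
  shows "occ T a u x < occ T a v x"
proof -
  have "v \<in> {p \<in> {a..v}. T ! p = x}" "v \<notin> {p \<in> {a..u}. T ! p = x}"
    "{p \<in> {a..u}. T ! p = x} \<subseteq> {p \<in> {a..v}. T ! p = x}"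
    using assms by auto
  then show ?thesis
    unfolding occ_def by (intro psubset_card_mono psubsetI) (simp, blast+)
qed

lemma occ_less_left:
  assumes "u \<le> b" "u < v" "T ! u = x"
  shows "occ T v b x < occ T u b x"
proof -
  have "u \<in> {p \<in> {u..b}. T ! p = x}" "u \<notin> {p \<in> {v..b}. T ! p = x}"
    "{p \<in> {v..b}. T ! p = x} \<subseteq> {p \<in> {u..b}. T ! p = x}"
    using assms by auto
  then show ?thesis
    unfolding occ_def by (intro psubset_card_mono psubsetI) (simp, blast+)
qed

lemma mode_freq_le_length: "mode_freq T a b \<le> Suc b - a"
proof -
  have "card {p \<in> {a..b}. T ! p = x} \<le> card {a..b}" for x
    by (intro card_mono) auto
  then show ?thesis
    by (simp add: mode_freq_le_iff occ_def)
qed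

text \<open>Each prepended position raises a count by at most one. This limits the increments of the
  first scan to the block length.\<close>

lemma mode_freq_extend:
  assumes "a \<le> p"
  shows "mode_freq T a b \<le> mode_freq T p b + (min p (Suc b) - a)"
  unfolding mode_freq_le_iff
proof
  fix x
  show "occ T a b x \<le> mode_freq T p b + (min p (Suc b) - a)"
  proof (cases "a \<le> b")
    case True
    have "card {i \<in> {a..<min p (Suc b)}. T ! i = x} \<le> card {a..<min p (Suc b)}"
      by (intro card_mono) auto
    moreover have "occ T (min p (Suc b)) b x = occ T p b x"
      by (cases "p \<le> Suc b") (simp_all add: occ_empty)
    ultimately show ?thesis
      using occ_split[of a "min p (Suc b)" b T x] assms True occ_le_mode_freq[of T p b x] by auto
  qed (simp add: occ_def)
qed

lemma mode_freq_mono: "a' \<le> a \<Longrightarrow> mode_freq T a b \<le> mode_freq T a' b"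
  unfolding mode_freq_le_iff[of T a b] using occ_mono[of a' a b b T] occ_le_mode_freq[of T a' b] order_trans by blast

text \<open>Counting from the first occurrence before \<open>p\<close>, or from \<open>p\<close> if
  there is none, loses nothing. So the scanned positions and the boundary together determine every
  count in the range.\<close>

lemma occ_cases:
  assumes "l \<le> p"
  obtains (prefix) q where "q \<in> {l..<min p (Suc r)}" "T ! q = x" "occ T l r x = occ T q r x"
    | (suffix) "occ T l r x = occ T p r x"
proof (cases "\<exists>q. q \<in> {l..<min p (Suc r)} \<and> T ! q = x")
  case True
  then obtain q where q: "q \<in> {l..<min p (Suc r)}" "T ! q = x"
    and least: "\<And>q'. q' < q \<Longrightarrow> \<not> (q' \<in> {l..<min p (Suc r)} \<and> T ! q' = x)"
    using exists_least_iff[of "\<lambda>q. q \<in> {l..<min p (Suc r)} \<and> T ! q = x"] by blast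
  have "{i \<in> {l..<q}. T ! i = x} = {}"
    using least q by auto
  then have "occ T l r x = occ T q r x"
    using occ_split[of l q r T x] q by auto
  with q show ?thesis by (rule prefix)
next
  case False
  have "p \<le> i" if "i \<in> {l..r}" "T ! i = x" for i
    by (rule ccontr) (use False that in auto)
  then have "{i \<in> {l..r}. T ! i = x} = {i \<in> {p..r}. T ! i = x}"
    using assms by auto
  then show ?thesis
    by (intro suffix) (simp add: occ_def)
qed

text \<open>Certifies the result of the first scan: by \<open>occ_cases\<close> each count is one
  from a scanned position or one from \<open>p\<close>.\<close>

lemma mode_freq_eqI:
  assumes "l \<le> p" "mode_freq T p r \<le> f" "f \<le> mode_freq T l r"
    and pre: "\<And>q. q \<in> {l..<min p (Suc r)} \<Longrightarrow> occ T q r (T ! q) \<le> f"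
  shows "mode_freq T l r = f"
proof -
  have "occ T l r x \<le> f" for x
    using \<open>l \<le> p\<close>
  proof (cases rule: occ_cases[of l p r T x])
    case (prefix q)
    then show ?thesis using pre by auto
  next
    case suffix
    then show ?thesis using occ_le_mode_freq[of T p r x] assms(2) by linarith
  qed
  then show ?thesis
    using assms(3) mode_freq_le_iff[of T l r f] by (intro antisym) blast+
qed

section \<open>Levels and their linked lists\<close>

text \<open>
  A position \<open>v \<ge> p\<close> is on level \<open>c\<close> if it is the \<open>c\<close>-th occurrence of its character from \<open>p\<close> on. Each
  character has at most one position on a level, and the modes of \<open>[p, r]\<close> are the characters on
  level \<open>mode_freq T p r\<close> up to \<open>r\<close>. A level is stored as a linked list: each position points to
  its predecessor. Pointers are shifted by one, \<open>0\<close> is the null pointer.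
\<close>

definition level :: "'a list \<Rightarrow> nat \<Rightarrow> nat \<Rightarrow> nat \<Rightarrow> nat list" where
  "level T p c b = rev (filter (\<lambda>v. p \<le> v \<and> occ T p v (T ! v) = c) [0..<b])"

fun last_on_level :: "'a list \<Rightarrow> nat \<Rightarrow> nat \<Rightarrow> nat \<Rightarrow> nat" where
  "last_on_level T p c 0 = 0"
| "last_on_level T p c (Suc b) =
    (if p \<le> b \<and> occ T p b (T ! b) = c then Suc b else last_on_level T p c b)"

lemma last_on_level_le: "last_on_level T p c b \<le> b"
  by (induction b) auto

lemma level_Nil: "last_on_level T p c b = 0 \<Longrightarrow> level T p c b = []"
  by (induction b) (auto simp: level_def split: if_splits)

lemma level_Cons: "last_on_level T p c b = Suc v \<Longrightarrow> level T p c b = v # level T p c v"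
  by (induction b) (auto simp: level_def split: if_splits)

lemma last_on_level_occ: "last_on_level T p c b = Suc v \<Longrightarrow> occ T p v (T ! v) = c"
  by (induction b) (auto split: if_splits)

section \<open>The enumerated sequence and its correctness\<close>

text \<open>The output in the order in which the query emits it. The condition on the frequencies
  mirrors the program, whose stored list head belongs to level
  \<open>mode_freq T p r\<close>.\<close>

definition listing :: "'a list \<Rightarrow> nat \<Rightarrow> nat \<Rightarrow> nat \<Rightarrow> 'a list" where
  "listing T l p r =
     map ((!) T) (filter (\<lambda>q. mode_freq T l r \<le> occ T q r (T ! q)) [l..<min p (Suc r)]
       @ (if mode_freq T p r = mode_freq T l r then level T p (mode_freq T l r) (Suc r) else []))"

text \<open>A count from \<open>q\<close> that reaches the mode frequency leaves no room for an
  earlier occurrence in the range, so a prefix mode is listed at its first occurrence only. The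
  remaining modes have no occurrence before \<open>p\<close> and are found on the level.\<close>

lemma listing_correct:
  assumes lr: "l \<le> r" and lp: "l \<le> p"
  shows "distinct (listing T l p r)" and "set (listing T l p r) = range_modes T l r"
proof -
  let ?f = "mode_freq T l r"
  have pos: "0 < ?f"
    using lr occ_pos_iff[of T l r "T ! l"] occ_le_mode_freq[of T l r "T ! l"] by force
  have A: "occ T q r (T ! q) = ?f \<and> occ T l r (T ! q) = ?f"
    if "?f \<le> occ T q r (T ! q)" "l \<le> q" for q
    using that occ_mono[of l q r r T "T ! q"] occ_le_mode_freq[of T l r "T ! q"] by linarith
  have B: "occ T p r (T ! v) = ?f \<and> occ T l r (T ! v) = ?f"
    if "p \<le> v" "v \<le> r" "occ T p v (T ! v) = ?f" for v
    using that lp occ_mono[of l p r r T "T ! v"] occ_le_mode_freq[of T l r "T ! v"]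
      occ_mono[of p p v r T "T ! v"] by linarith
  \<comment> \<open>Of two equal characters the earlier has the larger count, yet both counts equal
    \<open>?f\<close>.\<close>
  have dA: False if "?f \<le> occ T q r (T ! q)" "?f \<le> occ T q' r (T ! q')" "l \<le> q" "q < q'" "q \<le> r"
    "T ! q = T ! q'" for q q'
    using occ_less_left[OF that(5,4) refl, of T] A[OF that(1,3)] that(2,6) by simp
  have iA: "inj_on ((!) T) {q \<in> {l..<min p (Suc r)}. ?f \<le> occ T q r (T ! q)}"
  proof (rule linorder_inj_onI')
    fix u v
    assume "u \<in> {q \<in> {l..<min p (Suc r)}. ?f \<le> occ T q r (T ! q)}"
      "v \<in> {q \<in> {l..<min p (Suc r)}. ?f \<le> occ T q r (T ! q)}" "u < v"
    then show "T ! u \<noteq> T ! v"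
      using dA[of u v] by auto
  qed
  have iB: "inj_on ((!) T) {v. p \<le> v \<and> v \<le> r \<and> occ T p v (T ! v) = ?f}"
  proof (rule linorder_inj_onI')
    fix u v
    assume "u \<in> {v. p \<le> v \<and> v \<le> r \<and> occ T p v (T ! v) = ?f}"
      "v \<in> {v. p \<le> v \<and> v \<le> r \<and> occ T p v (T ! v) = ?f}" "u < v"
    then show "T ! u \<noteq> T ! v"
      using occ_less[of p v u T "T ! v"] by auto
  qed
  \<comment> \<open>An occurrence before \<open>p\<close> would add one to a count that is already
    maximal.\<close>
  have iAB: False if "?f \<le> occ T q r (T ! q)" "l \<le> q" "q < p" "q \<le> r"
    "p \<le> v" "v \<le> r" "occ T p v (T ! v) = ?f" "T ! q = T ! v" for q v
    using occ_less_left[OF that(4,3) refl, of T] A[OF that(1,2)] B[OF that(5-7)] that(8) by simp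
  have level_eq: "set (level T p ?f (Suc r)) = {v. p \<le> v \<and> v \<le> r \<and> occ T p v (T ! v) = ?f}"
    unfolding level_def by (auto simp: less_Suc_eq_le simp del: upt_Suc)
  show "distinct (listing T l p r)"
  proof -
    have "distinct (map ((!) T) (filter (\<lambda>q. ?f \<le> occ T q r (T ! q)) [l..<min p (Suc r)]))"
      using iA by (simp add: distinct_map)
    moreover have "distinct (map ((!) T) (level T p ?f (Suc r)))"
      using iB by (simp only: distinct_map level_eq) (simp add: level_def)
    moreover have "set (map ((!) T) (filter (\<lambda>q. ?f \<le> occ T q r (T ! q)) [l..<min p (Suc r)])) \<inter>
        set (map ((!) T) (level T p ?f (Suc r))) = {}"
      unfolding set_map level_eq using iAB by force
    ultimately show ?thesis
      by (simp add: listing_def)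
  qed
  show "set (listing T l p r) = range_modes T l r"
    unfolding range_modes_eq[OF lr]
  proof (intro equalityI subsetI)
    fix x
    assume "x \<in> set (listing T l p r)"
    then consider q where "x = T ! q" "?f \<le> occ T q r (T ! q)" "l \<le> q"
      | v where "x = T ! v" "p \<le> v" "v \<le> r" "occ T p v (T ! v) = ?f"
      unfolding listing_def set_map set_append image_Un
      by (fastforce simp: level_eq split: if_splits)
    then show "x \<in> {x. occ T l r x = ?f}"
      by cases (use A B in blast)+
  next
    fix x
    assume "x \<in> {x. occ T l r x = ?f}"
    then have x: "occ T l r x = ?f" by simp
    show "x \<in> set (listing T l p r)"
      using lp
    proof (cases rule: occ_cases[of l p r T x])
      case (prefix q)
      then show ?thesis using x by (auto simp: listing_def simp del: upt_Suc)
    next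
      case eq: suffix
      have mf: "mode_freq T p r = ?f"
        using x eq occ_le_mode_freq[of T p r x] mode_freq_mono[OF lp, of T r] by linarith
      \<comment> \<open>The last occurrence of \<open>x\<close> up to \<open>r\<close> already sees
        all of its occurrences from \<open>p\<close> on, so it is the one on level
        \<open>?f\<close>.\<close>
      define V where "V = {v \<in> {p..r}. T ! v = x}"
      have V: "finite V" "V \<noteq> {}"
        using eq x pos occ_pos_iff[of T p r x] by (auto simp: V_def)
      define v where "v = Max V"
      have v: "v \<in> V" "\<And>u. u \<in> V \<Longrightarrow> u \<le> v"
        using V by (auto simp: v_def)
      have "occ T p v x = occ T p r x"
        unfolding occ_def using v by (intro arg_cong[where f = card]) (auto simp: V_def)
      then have "v \<in> set (level T p ?f (Suc r))" "T ! v = x"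
        using v(1) x eq unfolding level_eq by (auto simp: V_def)
      then show ?thesis
        using mf by (auto simp: listing_def)
    qed
  qed
qed

section \<open>Counting by one lookup in a sorted list\<close>

text \<open>The elements of the interval occupy consecutive indices from \<open>j\<close> on, so
  there are more than \<open>g\<close> of them exactly if index \<open>j + g\<close> still holds
  one.\<close>

lemma card_interval_sorted:
  fixes xs :: "'a :: linorder list"
  assumes sorted: "sorted_wrt (<) xs" and j: "j < length xs"
  shows "g < card {x \<in> set xs. xs ! j \<le> x \<and> x \<le> b} \<longleftrightarrow> j + g < length xs \<and> xs ! (j + g) \<le> b"
    (is "g < card ?A \<longleftrightarrow> ?R")
proof
  assume ?R
  then have "(!) xs ` {j..j + g} \<subseteq> ?A"
    using sorted by (auto simp: strict_sorted_iff sorted_nth_mono intro: order_trans[OF sorted_nth_mono])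
  then have "card ((!) xs ` {j..j + g}) \<le> card ?A"
    by (intro card_mono) auto
  moreover have "inj_on ((!) xs) {j..j + g}"
    using sorted \<open>?R\<close> by (intro inj_on_nth) (auto simp: strict_sorted_iff)
  ultimately show "g < card ?A"
    by (simp add: card_image)
next
  assume g: "g < card ?A"
  show ?R
  proof (rule ccontr)
    assume neg: "\<not> ?R"
    have "?A \<subseteq> (!) xs ` {j..<j + g}"
    proof
      fix x assume "x \<in> ?A"
      then obtain i where i: "i < length xs" "x = xs ! i" "xs ! j \<le> xs ! i" "xs ! i \<le> b"
        by (auto simp: in_set_conv_nth)
      have "j \<le> i"
        using sorted_wrt_nth_less[OF sorted, of i j] i j by force
      moreover have "i < j + g"
        using neg i sorted by (metis dual_order.strict_trans1 not_le order_trans sorted_nth_mono strict_sorted_iff)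
      ultimately show "x \<in> (!) xs ` {j..<j + g}"
        using i by auto
    qed
    then have "card ?A \<le> card ((!) xs ` {j..<j + g})"
      by (intro card_mono) auto
    also have "\<dots> \<le> g"
      using card_image_le[of "{j..<j + g}" "(!) xs"] by simp
    finally show False using g by simp
  qed
qed

text \<open>In the lexicographic order the occurrences of a character are contiguous and their
  positions increase.\<close>

definition sorted_occs :: "'a :: linorder list \<Rightarrow> ('a \<times> nat) list" where
  "sorted_occs T = sorted_list_of_set ((\<lambda>p. (T ! p, p)) ` {..<length T})"

definition rank :: "'a :: linorder list \<Rightarrow> nat \<Rightarrow> nat" where
  "rank T q = (LEAST j. j < length T \<and> sorted_occs T ! j = (T ! q, q))"

lemma set_sorted_occs: "set (sorted_occs T) = (\<lambda>p. (T ! p, p)) ` {..<length T}"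
  by (simp add: sorted_occs_def)

lemma length_sorted_occs: "length (sorted_occs T) = length T"
  by (simp add: sorted_occs_def card_image inj_on_def)

lemma sorted_occs_nth: "j < length T \<Longrightarrow> \<exists>p < length T. sorted_occs T ! j = (T ! p, p)"
  using set_sorted_occs[of T] length_sorted_occs[of T] nth_mem[of j "sorted_occs T"] by auto

lemma rank:
  assumes "q < length T"
  shows "rank T q < length T" "sorted_occs T ! rank T q = (T ! q, q)"
proof -
  have "(T ! q, q) \<in> set (sorted_occs T)"
    using assms by (simp add: set_sorted_occs)
  then have "\<exists>j. j < length T \<and> sorted_occs T ! j = (T ! q, q)"
    by (auto simp: in_set_conv_nth length_sorted_occs)
  from LeastI_ex[OF this] show "rank T q < length T" "sorted_occs T ! rank T q = (T ! q, q)"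
    by (auto simp: rank_def)
qed

text \<open>The occurrences of \<open>T ! q\<close> in \<open>[q, r]\<close> form the interval from
  \<open>(T ! q, q)\<close> to \<open>(T ! q, r)\<close>. Position and character are compared
  separately: only positions are stored, characters are read from the string.\<close>

lemma less_occ_iff:
  fixes T :: "'a :: linorder list" and g :: nat
  assumes q: "q < length T" and r: "r < length T"
  defines "j \<equiv> rank T q + g"
  shows "g < occ T q r (T ! q) \<longleftrightarrow> j < length T \<and>
    snd (sorted_occs T ! j) \<le> r \<and> T ! snd (sorted_occs T ! j) = T ! q"
proof -
  let ?xs = "sorted_occs T"
  have sorted: "sorted_wrt (<) ?xs"
    unfolding sorted_occs_def by (rule strict_sorted_list_of_set)
  have "{x \<in> set ?xs. ?xs ! rank T q \<le> x \<and> x \<le> (T ! q, r)} =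
      (\<lambda>p. (T ! p, p)) ` {p \<in> {q..r}. T ! p = T ! q}"
    unfolding rank[OF q] set_sorted_occs using r q by (auto simp: image_iff)
  then have "card {x \<in> set ?xs. ?xs ! rank T q \<le> x \<and> x \<le> (T ! q, r)} = occ T q r (T ! q)"
    by (simp add: occ_def card_image inj_on_def)
  then have *: "g < occ T q r (T ! q) \<longleftrightarrow> j < length T \<and> ?xs ! j \<le> (T ! q, r)"
    using card_interval_sorted[OF sorted, of "rank T q" g "(T ! q, r)"] rank[OF q]
    by (simp add: length_sorted_occs j_def)
  have "?xs ! j \<le> (T ! q, r) \<longleftrightarrow> snd (?xs ! j) \<le> r \<and> T ! snd (?xs ! j) = T ! q" if j: "j < length T"
  proof -
    have "?xs ! rank T q \<le> ?xs ! j"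
      using sorted j unfolding j_def
      by (intro sorted_nth_mono) (auto simp: strict_sorted_iff length_sorted_occs)
    moreover obtain p where "p < length T" "?xs ! j = (T ! p, p)"
      using sorted_occs_nth[OF j] by auto
    ultimately show ?thesis
      using rank[OF q] by auto
  qed
  with * show ?thesis by auto
qed

section \<open>Time-bounded execution\<close>

text \<open>Total correctness with an upper bound on the time, so that bounds can be relaxed and
  added.\<close>

definition runs ::
  "nat \<Rightarrow> nat list \<Rightarrow> bool list \<Rightarrow> com \<Rightarrow> state \<Rightarrow> nat \<Rightarrow> (state \<Rightarrow> bool) \<Rightarrow> bool" where
  "runs w T D P s b \<Phi> \<longleftrightarrow> (\<exists>t s'. exec w T D P s t s' \<and> t \<le> b \<and> \<Phi> s')"

lemma runs_mono:
  "runs w T D P s b \<Phi> \<Longrightarrow> b \<le> b' \<Longrightarrow> (\<And>s'. \<Phi> s' \<Longrightarrow> \<Psi> s') \<Longrightarrow> runs w T D P s b' \<Psi>"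
  unfolding runs_def by (meson order_trans)

lemma runs_Seq:
  assumes "runs w T D P s b \<Phi>" "\<And>s'. \<Phi> s' \<Longrightarrow> runs w T D Q s' b' \<Psi>"
  shows "runs w T D (Seq P Q) s (b + b') \<Psi>"
  using assms unfolding runs_def by (meson add_mono exec.Seq)

lemma runs_If:
  assumes "regs s x \<noteq> 0 \<Longrightarrow> runs w T D P s b \<Phi>" "regs s x = 0 \<Longrightarrow> runs w T D Q s b \<Phi>"
  shows "runs w T D (If x P Q) s (b + 1) \<Phi>"
proof (cases "regs s x = 0")
  case True
  then show ?thesis
    using assms(2) exec.IfFalse[OF True] unfolding runs_def by (meson add_mono order_refl)
next
  case False
  then show ?thesis
    using assms(1) exec.IfTrue[OF False] unfolding runs_def by (meson add_mono order_refl)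
qed

text \<open>In \<open>I m s\<close> the number \<open>m\<close> is the time credit that is left for the remaining iterations.\<close>

lemma runs_While:
  assumes body: "\<And>m s. I m s \<Longrightarrow> regs s x \<noteq> 0 \<Longrightarrow>
      runs w T D P s c (\<lambda>s'. \<exists>m'. I m' s' \<and> m' + c + 1 \<le> m)"
    and "I m s"
  shows "runs w T D (While x P) s (m + 1) (\<lambda>s'. (\<exists>m'. I m' s') \<and> regs s' x = 0)"
  using \<open>I m s\<close>
proof (induction m arbitrary: s rule: less_induct)
  case (less m)
  show ?case
  proof (cases "regs s x = 0")
    case True
    then show ?thesis
      using less.prems exec.WhileFalse[OF True] unfolding runs_def by (meson le_add2)
  next
    case False
    then obtain t s1 m1 where 1: "exec w T D P s t s1" "t \<le> c" "I m1 s1" "m1 + c + 1 \<le> m"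
      using body[OF less.prems] unfolding runs_def by blast
    then have "m1 < m" by simp
    from less.IH[OF this 1(3)] obtain t' s2 where
      2: "exec w T D (While x P) s1 t' s2" "t' \<le> m1 + 1" "\<exists>m'. I m' s2" "regs s2 x = 0"
      unfolding runs_def by blast
    have "exec w T D (While x P) s (t + t' + 1) s2"
      by (rule exec.WhileTrue[OF False 1(1) 2(1)])
    moreover have "t + t' + 1 \<le> m + 1"
      using 1 2 by linarith
    ultimately show ?thesis
      using 2 unfolding runs_def by blast
  qed
qed

text \<open>An evaluator that simplification can run symbolically; \<open>runs_straightI\<close>
  converts its result into an execution.\<close>

fun steps :: "nat \<Rightarrow> nat list \<Rightarrow> bool list \<Rightarrow> instr list \<Rightarrow> state \<Rightarrow> state option" where
  "steps w T D [] s = Some s"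
| "steps w T D (i # is) s = (case step w T D i s of None \<Rightarrow> None | Some s' \<Rightarrow> steps w T D is s')"

lemma steps_append:
  "steps w T D (is @ js) s = (case steps w T D is s of None \<Rightarrow> None | Some s' \<Rightarrow> steps w T D js s')"
  by (induction "is" arbitrary: s) (auto split: option.splits)

text \<open>The empty list never occurs: there is no program that takes no time.\<close>

fun straight :: "instr list \<Rightarrow> com" where
  "straight [] = Do (Const 0 0)"
| "straight [i] = Do i"
| "straight (i # is) = Seq (Do i) (straight is)"

lemma exec_straight:
  "is \<noteq> [] \<Longrightarrow> steps w T D is s = Some s' \<Longrightarrow> exec w T D (straight is) s (length is) s'"
proof (induction "is" arbitrary: s rule: straight.induct)
  case (2 i)
  then show ?case
    using exec.Do[of w T D i s s'] by (auto split: option.splits)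
next
  case (3 i j js)
  then obtain s1 where "step w T D i s = Some s1" "steps w T D (j # js) s1 = Some s'"
    by (auto split: option.splits)
  then show ?case
    using exec.Seq[OF exec.Do[of w T D i s s1] "3.IH"[of s1]] by simp
qed simp

lemma runs_straightI:
  assumes "is \<noteq> []" "length is \<le> b" "case steps w T D is s of None \<Rightarrow> False | Some s' \<Rightarrow> \<Phi> s'"
  shows "runs w T D (straight is) s b \<Phi>"
  using exec_straight[OF assms(1), of w T D s] assms(2,3)
  unfolding runs_def by (auto split: option.splits)

lemma runs_Do:
  assumes "case step w T D i s of None \<Rightarrow> False | Some s' \<Rightarrow> \<Phi> s'"
  shows "runs w T D (Do i) s 1 \<Phi>"
  using assms exec.Do[of w T D i s] unfolding runs_def by (auto split: option.splits)

section \<open>The data structure and its query\<close>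

definition bits :: "nat \<Rightarrow> nat \<Rightarrow> bool list" where
  "bits k v = map (bit v) [0..<k]"

text \<open>One program serves all lengths, so the entry width must be stored as well. Its unary
  form can be decoded before any width is known.\<close>

definition encode :: "nat \<Rightarrow> nat list \<Rightarrow> bool list" where
  "encode k xs = replicate k True @ False # concat (map (bits k) xs)"

lemma length_concat_bits: "length (concat (map (bits k) xs)) = length xs * k"
  by (induction xs) (auto simp: bits_def)

lemma length_encode: "length (encode k xs) = Suc k + length xs * k"
  by (simp add: encode_def length_concat_bits)

lemma take_drop_concat_bits:
  "j < length xs \<Longrightarrow> take k (drop (j * k) (concat (map (bits k) xs))) = bits k (xs ! j)"
proof (induction xs arbitrary: j)
  case (Cons x xs)
  have "length (bits k x) = k" by (simp add: bits_def)
  then show ?case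
    using Cons by (cases j) auto
qed simp

lemma bit_field_encode:
  assumes "j < length xs" "xs ! j < 2 ^ k"
  shows "bit_field (encode k xs) (j * k + Suc k) k = xs ! j"
proof -
  have "drop (j * k + Suc k) (encode k xs) = drop (j * k) (concat (map (bits k) xs))"
    by (simp add: encode_def)
  then show ?thesis
    using assms
    by (simp add: bit_field_def take_drop_concat_bits bits_def horner_sum_bit_eq_take_bit
        take_bit_nat_eq_self)
qed

lemma bit_field_single: "i < length D \<Longrightarrow> bit_field D i (Suc 0) = of_bool (D ! i)"
  by (simp add: bit_field_def take_Suc_conv_app_nth Cons_nth_drop_Suc[symmetric])

lemma bit_field_encode_header:
  "i \<le> k \<Longrightarrow> bit_field (encode k xs) i (Suc 0) = of_bool (i < k)"
  by (cases "i = k") (simp_all add: bit_field_single length_encode, simp_all add: encode_def nth_append)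

section \<open>Contents of the table\<close>

text \<open>
  Record \<open>v = i * n + u\<close> belongs to the block boundary \<open>p = (i + 1) * s\<close> and the position \<open>u\<close>.
  Fields 3 and 4 only matter in row 0; fields 5 and 6 hold the parameters \<open>n\<close> and \<open>s\<close>.
\<close>

definition entry :: "nat list \<Rightarrow> nat \<Rightarrow> nat \<Rightarrow> nat \<Rightarrow> nat" where
  "entry T s v c =
    (let p = (v div length T + 1) * s; u = v mod length T in
     [mode_freq T p u,
      last_on_level T p (mode_freq T p u) (Suc u),
      last_on_level T p (occ T p u (T ! u)) u,
      rank T u,
      snd (sorted_occs T ! u),
      length T,
      s] ! c)"

text \<open>Makes every entry fit into \<open>k\<close> bits once \<open>length T < 2 ^ k\<close>;
  the shifted pointers can attain the length itself.\<close>

lemma entry_le: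
  assumes "T \<noteq> []" "s \<le> length T" "c < 7"
  shows "entry T s v c \<le> length T"
proof -
  define u where "u = v mod length T"
  define p where "p = (v div length T + 1) * s"
  have u: "u < length T" using assms by (simp add: u_def)
  have "c \<in> {0, 1, 2, 3, 4, 5, 6}" using assms by auto
  then show ?thesis
    using u assms rank(1)[OF u] sorted_occs_nth[OF u] mode_freq_le_length[of T p u]
      last_on_level_le[of T p "mode_freq T p u" "Suc u"]
      last_on_level_le[of T p "occ T p u (T ! u)" u]
    unfolding entry_def Let_def u_def[symmetric] p_def[symmetric]
    by (elim insertE) (auto simp del: last_on_level.simps)
qed

text \<open>The row of a query is \<open>l div s\<close>, at most \<open>length T div s\<close>. The
  boundary of the last row lies beyond the string.\<close>

definition rows :: "nat list \<Rightarrow> nat \<Rightarrow> nat" where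
  "rows T s = length T div s + 1"

definition table :: "nat list \<Rightarrow> nat \<Rightarrow> nat list" where
  "table T s = map (\<lambda>j. entry T s (j div 7) (j mod 7)) [0..<7 * (rows T s * length T)]"

section \<open>The query program\<close>

text \<open>
  Registers: 0 and 1 the query, 2 the entry width \<open>k\<close>, 3 the position \<open>k + 1\<close> of the table, 4 and 5
  \<open>n\<close> and the block length, 6 the current frequency, 7 the scan position, 8 the end of the scanned
  prefix, 9 the mode frequency from the block boundary on, 10 a level pointer, 11 the constant 1,
  12 the offset of the row, 13 a condition, 17 the argument of \<open>test\<close>, 18 the constant 0; the others
  are scratch.
\<close>

definition fetch :: "reg \<Rightarrow> reg \<Rightarrow> nat \<Rightarrow> instr list" where
  "fetch x v c = [Const 14 7, Arith Mul 14 v 14, Const 15 c, Arith Add 14 14 15,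
     Arith Mul 14 14 2, Arith Add 14 14 3, ReadBits x 14 2]"

lemma length_fetch [simp]: "length (fetch x v c) = 7" "fetch x v c \<noteq> []"
  by (simp_all add: fetch_def)

text \<open>Evaluates the right-hand side of \<open>less_occ_iff\<close> with \<open>g\<close> in
  register 17. The branch prevents a lookup past the sorted list.\<close>

definition test :: com where
  "test = Seq (straight (fetch 19 7 3 @ [Arith Add 19 19 17, Arith Less 13 19 4]))
     (If 13
       (straight (fetch 19 19 4 @ [Arith Less 13 1 19, Arith Equal 13 13 18,
          ReadChar 19 19, ReadChar 20 7, Arith Equal 19 19 20, Arith Mul 13 13 19]))
       (Do (Const 13 0)))"

text \<open>Register 2 starts at 0 and is both bit position and counter; the terminating zero bit of
  the header stops it at \<open>k\<close>.\<close>

definition read_width :: com where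
  "read_width = Seq (straight [Const 11 1, ReadBits 13 2 11])
     (While 13 (straight [Arith Add 2 2 11, ReadBits 13 2 11]))"

text \<open>The parameters come from record 0, addressed through the zero register 18. The minimum
  of \<open>p\<close> and \<open>r + 1\<close> is selected by multiplying each candidate with a 0/1
  condition.\<close>

definition prepare :: com where
  "prepare = straight ([Arith Add 3 2 11] @ fetch 4 18 5 @ fetch 5 18 6 @
     [Arith Div 12 0 5, Arith Add 8 12 11, Arith Mul 8 8 5, Arith Mul 12 12 4,
      Arith Add 14 1 11, Arith Less 13 14 8, Arith Sub 15 11 13, Arith Mul 8 8 15,
      Arith Mul 14 14 13, Arith Add 8 8 14, Arith Add 19 12 1] @
     fetch 6 19 0 @ fetch 10 19 1 @ [Arith Add 9 6 18, Arith Add 7 0 18, Arith Less 13 7 8])"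

text \<open>
  A round either increments the frequency or advances the scan. The frequency grows by at most the
  length of the scanned prefix, hence the number of rounds is linear in the block length.
\<close>

definition find_mode_freq :: com where
  "find_mode_freq = While 13 (Seq (Do (Arith Add 17 6 18)) (Seq test
     (straight [Arith Add 6 6 13, Arith Sub 14 11 13, Arith Add 7 7 14, Arith Less 13 7 8])))"

text \<open>The multiplication clears the list pointer if the prefix has raised the frequency. The
  threshold is lowered by one because \<open>test\<close> is strict.\<close>

definition rewind :: com where
  "rewind = straight [Arith Equal 14 6 9, Arith Mul 10 10 14, Arith Sub 17 6 11,
     Arith Add 7 0 18, Arith Less 13 7 8]"

definition emit_prefix :: com where
  "emit_prefix = While 13 (Seq test (Seq
     (If 13 (straight [ReadChar 14 7, Emit 14]) (Do (Const 14 0)))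
     (straight [Arith Add 7 7 11, Arith Less 13 7 8])))"

definition emit_level :: com where
  "emit_level = While 10 (straight ([Arith Sub 10 10 11, ReadChar 14 10, Emit 14,
     Arith Add 19 12 10] @ fetch 10 19 2))"

definition query :: com where
  "query = Seq read_width (Seq prepare (Seq find_mode_freq (Seq rewind
     (Seq emit_prefix emit_level))))"

section \<open>Correctness and running time for one string and query\<close>

text \<open>The bound on \<open>length D\<close> is what keeps addresses and intermediate results
  from wrapping around.\<close>

locale mode_structure =
  fixes w k s l r :: nat and T :: "nat list" and D :: "bool list"
  assumes D: "D = encode k (table T s)"
    and k: "0 < k" "k \<le> w" "length T < 2 ^ k"
    and s: "0 < s" "s \<le> length T"
    and size: "length D < 2 ^ w"
    and lr: "l \<le> r" "r < length T"
begin

abbreviation "n \<equiv> length T"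
abbreviation "M \<equiv> rows T s * length T"
abbreviation "i0 \<equiv> l div s"
abbreviation "p \<equiv> (i0 + 1) * s"
abbreviation "e \<equiv> min p (Suc r)"
abbreviation "mf \<equiv> mode_freq T l r"
abbreviation "f0 \<equiv> mode_freq T p r"

lemma length_D: "length D = Suc k + 7 * M * k"
  by (simp add: D length_encode table_def)

text \<open>The table has \<open>7 * M\<close> entries of at least one bit each, so these numbers
  stay below \<open>length D\<close>.\<close>

lemma bound: "x \<le> 7 * M \<Longrightarrow> x < 2 ^ w"
proof -
  assume "x \<le> 7 * M"
  also have "\<dots> \<le> 7 * M * k" using k by simp
  also have "\<dots> < 2 ^ w" using size length_D by linarith
  finally show ?thesis .
qed

lemma n_le_M: "n \<le> M"
  by (simp add: rows_def)

lemma mod_small: "x \<le> n \<Longrightarrow> x mod 2 ^ w = x"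
  using n_le_M by (intro mod_less bound) linarith

lemma one_le_M: "1 \<le> M"
  using n_le_M lr by linarith

lemma of_bool_mod [simp]: "of_bool b mod (2 ^ w :: nat) = of_bool b"
  using k by (cases b) auto

lemma w_pos [simp]: "0 < w"
  using k by simp

text \<open>Machine subtraction adds \<open>2 ^ w\<close> first; this normalises
  \<open>1 - 0\<close>.\<close>

lemma Suc_mod [simp]: "Suc (2 ^ w) mod 2 ^ w = Suc 0"
proof -
  have "(1 + 2 ^ w) mod 2 ^ w = 1 mod (2 ^ w :: nat)"
    by (rule mod_add_self2)
  also have "\<dots> = 1"
    by (rule mod_small) (use lr in linarith)
  finally have "(1 + 2 ^ w) mod 2 ^ w = (1 :: nat)" .
  then show ?thesis by simp
qed

lemma T_nonempty: "T \<noteq> []" "0 < rows T s"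
  using lr by (auto simp: rows_def)

lemma row_bound: "u < n \<Longrightarrow> i0 * n + u < M"
proof -
  assume "u < n"
  moreover have "i0 * n \<le> n div s * n"
    using lr by (intro mult_right_mono div_le_mono) auto
  ultimately show ?thesis
    unfolding rows_def distrib_right by linarith
qed

lemma p_bounds: "l < p" "p \<le> l + s"
proof -
  have "l mod s < s" using s by simp
  moreover have "l = i0 * s + l mod s" by simp
  moreover have "p = i0 * s + s" by simp
  ultimately show "l < p" "p \<le> l + s"
    by linarith+
qed

text \<open>The field read ends inside \<open>D\<close>, so its address does not wrap. Register 14
  is overwritten before \<open>v\<close> is read, hence \<open>v \<noteq> 14\<close>.\<close>

lemma steps_fetch:
  assumes "regs \<sigma> 2 = k" "regs \<sigma> 3 = Suc k" "regs \<sigma> v < M" "v \<noteq> 14" "c < 7"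
  shows "steps w T D (fetch x v c) \<sigma> = Some (\<sigma>\<lparr>regs := (regs \<sigma>)
    (14 := (regs \<sigma> v * 7 + c) * k + Suc k, 15 := c, x := entry T s (regs \<sigma> v) c)\<rparr>)"
proof -
  let ?V = "regs \<sigma> v"
  have V: "?V * 7 + c < 7 * M" using assms by linarith
  then have "Suc (?V * 7 + c) * k \<le> 7 * M * k"
    by (intro mult_right_mono) auto
  then have addr: "(?V * 7 + c) * k + Suc k + k \<le> length D"
    by (simp add: length_D)
  then have m3: "((?V * 7 + c) * k + Suc k) mod 2 ^ w = (?V * 7 + c) * k + Suc k"
    and m2: "((?V * 7 + c) * k) mod 2 ^ w = (?V * 7 + c) * k"
    using size by auto
  have m1: "(?V * 7 + c) mod 2 ^ w = ?V * 7 + c" "?V * 7 mod 2 ^ w = ?V * 7" "7 mod 2 ^ w = (7::nat)"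
    "c mod 2 ^ w = c"
    using V one_le_M assms by (auto intro!: mod_less bound)
  have j: "?V * 7 + c < length (table T s)" "table T s ! (?V * 7 + c) = entry T s ?V c"
    using V assms by (auto simp: table_def)
  have "entry T s ?V c < 2 ^ k"
    using entry_le[of T s c ?V] s k assms by fastforce
  then have "bit_field D ((?V * 7 + c) * k + Suc k) k = entry T s ?V c"
    using bit_field_encode[of "?V * 7 + c" "table T s" k] j by (simp add: D)
  then show ?thesis
    using assms addr m1 m2 m3 k by (simp add: fetch_def set_reg_def fun_upd_twist)
qed

lemma entry_eqs:
  assumes "q < n"
  shows "entry T s q 3 = rank T q" "entry T s q 4 = snd (sorted_occs T ! q)"
    "entry T s (i0 * n + q) 0 = mode_freq T p q"
    "entry T s (i0 * n + q) (Suc 0) = last_on_level T p (mode_freq T p q) (Suc q)"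
    "entry T s (i0 * n + q) 2 = last_on_level T p (occ T p q (T ! q)) q"
proof -
  have "T \<noteq> []"
    using assms by auto
  then have "(i0 * n + q) div n = i0" "(i0 * n + q) mod n = q"
    using assms by simp_all
  then show "entry T s q 3 = rank T q" "entry T s q 4 = snd (sorted_occs T ! q)"
    "entry T s (i0 * n + q) 0 = mode_freq T p q"
    "entry T s (i0 * n + q) (Suc 0) = last_on_level T p (mode_freq T p q) (Suc q)"
    "entry T s (i0 * n + q) 2 = last_on_level T p (occ T p q (T ! q)) q"
    using assms by (simp_all add: entry_def Let_def del: last_on_level.simps)
qed

lemma entry_params: "entry T s v 5 = n" "entry T s v 6 = s"
  by (simp_all add: entry_def Let_def)

text \<open>The registers that keep their values throughout the scans.\<close>

definition env :: "state \<Rightarrow> bool" where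
  "env \<sigma> \<longleftrightarrow> regs \<sigma> 0 = l \<and> regs \<sigma> (Suc 0) = r \<and> regs \<sigma> 2 = k \<and> regs \<sigma> 3 = Suc k \<and>
     regs \<sigma> 4 = n \<and> regs \<sigma> 8 = e \<and> regs \<sigma> 9 = f0 \<and> regs \<sigma> 11 = 1 \<and>
     regs \<sigma> 12 = i0 * n \<and> regs \<sigma> 18 = 0"

text \<open>The bound is 9 for the rank lookup and comparison, 1 for the branch and at most 13 after
  it.\<close>

lemma runs_test:
  assumes env: "env \<sigma>" and q: "regs \<sigma> 7 = q" "q \<le> r" and g: "regs \<sigma> 17 = g" "g \<le> n"
  shows "runs w T D test \<sigma> 23 (\<lambda>\<sigma>'. emitted \<sigma>' = emitted \<sigma> \<and>
    regs \<sigma>' 13 = of_bool (g < occ T q r (T ! q)) \<and>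
    (\<forall>x. x \<notin> {13, 14, 15, 19, 20} \<longrightarrow> regs \<sigma>' x = regs \<sigma> x))"
    (is "runs _ _ _ _ _ _ ?post")
proof -
  have qn: "q < n" using q lr by simp
  have qM: "q < M" using qn n_le_M by linarith
  have sum: "(rank T q + g) mod 2 ^ w = rank T q + g"
    using rank(1)[OF qn] g n_le_M by (intro mod_less bound) linarith
  let ?j = "rank T q + g"
  let ?mid = "\<lambda>\<sigma>'. emitted \<sigma>' = emitted \<sigma> \<and> regs \<sigma>' 13 = of_bool (?j < n) \<and> regs \<sigma>' 19 = ?j \<and>
    (\<forall>x. x \<notin> {13, 14, 15, 19} \<longrightarrow> regs \<sigma>' x = regs \<sigma> x)"
  have "runs w T D (straight (fetch 19 7 3 @ [Arith Add 19 19 17, Arith Less 13 19 4])) \<sigma> 9 ?mid"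
    using env q g qn qM
    by (intro runs_straightI)
      (simp_all add: steps_append steps_fetch env_def entry_eqs sum set_reg_def)
  moreover have "runs w T D (If 13
       (straight (fetch 19 19 4 @ [Arith Less 13 1 19, Arith Equal 13 13 18,
          ReadChar 19 19, ReadChar 20 7, Arith Equal 19 19 20, Arith Mul 13 13 19]))
       (Do (Const 13 0))) \<sigma>' 14 ?post" if mid: "?mid \<sigma>'" for \<sigma>'
  proof (cases "?j < n")
    case True
    have jM: "?j < M" using True n_le_M by linarith
    have y: "snd (sorted_occs T ! ?j) < n"
      using sorted_occs_nth[OF True] by auto
    have env': "env \<sigma>'" and q': "regs \<sigma>' 7 = q" "regs \<sigma>' 19 = ?j"
      using env q mid by (simp_all add: env_def)
    have "runs w T D (straight (fetch 19 19 4 @ [Arith Less 13 1 19, Arith Equal 13 13 18,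
        ReadChar 19 19, ReadChar 20 7, Arith Equal 19 19 20, Arith Mul 13 13 19])) \<sigma>' 13 ?post"
      using env' q' True y qn jM mid less_occ_iff[OF qn lr(2), of g]
      by (intro runs_straightI)
        (simp_all add: steps_append steps_fetch env_def entry_eqs set_reg_def)
    then show ?thesis
      using runs_If[of \<sigma>' 13 w T D _ 13 ?post] mid True by simp
  next
    case False
    then have "\<not> g < occ T q r (T ! q)"
      using less_occ_iff[OF qn lr(2), of g] by simp
    then have "runs w T D (Do (Const 13 0)) \<sigma>' 1 ?post"
      using mid by (intro runs_Do) (simp add: set_reg_def)
    then have "runs w T D (Do (Const 13 0)) \<sigma>' 13 ?post"
      by (rule runs_mono) simp_all
    then show ?thesis
      using runs_If[of \<sigma>' 13 w T D _ 13 ?post] mid False by simp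
  qed
  ultimately show ?thesis
    unfolding test_def using runs_Seq[of w T D _ \<sigma> 9 ?mid _ 14 ?post] by simp
qed

lemma l_less_e: "l < e"
  using p_bounds lr by simp

lemma e_le: "e \<le> Suc r" "e - l \<le> s"
  using p_bounds by linarith+

lemma mf_le: "mf \<le> n" "mf \<le> f0 + (e - l)" "f0 \<le> mf" "0 < mf"
proof -
  show "mf \<le> n" "mf \<le> f0 + (e - l)" "f0 \<le> mf"
    using mode_freq_le_length[of T l r] lr mode_freq_extend[of l p T r] mode_freq_mono[of l p T r]
      p_bounds(1) by linarith+
  have "0 < occ T l r (T ! l)"
    using lr unfolding occ_pos_iff by auto
  then show "0 < mf"
    using occ_le_mode_freq[of T l r "T ! l"] by linarith
qed

lemma runs_find_mode_freq:
  assumes "env \<sigma>" "regs \<sigma> 6 = f0" "regs \<sigma> 7 = l" "regs \<sigma> 13 = of_bool (l < e)"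
  shows "runs w T D find_mode_freq \<sigma> (29 * ((e - l) + (mf - f0)) + 1)
    (\<lambda>\<sigma>'. env \<sigma>' \<and> emitted \<sigma>' = emitted \<sigma> \<and> regs \<sigma>' 10 = regs \<sigma> 10 \<and> regs \<sigma>' 6 = mf)"
proof -
  define J where "J q f \<sigma>' \<longleftrightarrow> env \<sigma>' \<and> emitted \<sigma>' = emitted \<sigma> \<and> regs \<sigma>' 10 = regs \<sigma> 10 \<and>
    regs \<sigma>' 7 = q \<and> regs \<sigma>' 6 = f \<and> regs \<sigma>' 13 = of_bool (q < e)" for q f and \<sigma>' :: state
  \<comment> \<open>\<open>f\<close> stays between the counts already scanned and the true
    frequency. A round costs 1 + 23 + 4 for the body and 1 for the loop test, and lowers
    \<open>(e - q) + (mf - f)\<close> by one.\<close>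
  define I where "I m \<sigma>' \<longleftrightarrow> (\<exists>q f. J q f \<sigma>' \<and> l \<le> q \<and> q \<le> e \<and> f0 \<le> f \<and> f \<le> mf \<and>
    (\<forall>q'\<in>{l..<q}. occ T q' r (T ! q') \<le> f) \<and> m = 29 * ((e - q) + (mf - f)))" for m \<sigma>'
  have init: "I (29 * ((e - l) + (mf - f0))) \<sigma>"
    unfolding I_def J_def using assms l_less_e mf_le by (intro exI[of _ l] exI[of _ f0]) auto
  have body: "runs w T D (Seq (Do (Arith Add 17 6 18)) (Seq test
     (straight [Arith Add 6 6 13, Arith Sub 14 11 13, Arith Add 7 7 14, Arith Less 13 7 8]))) \<tau> 28
     (\<lambda>\<sigma>'. \<exists>m'. I m' \<sigma>' \<and> m' + 28 + 1 \<le> m)" if I: "I m \<tau>" and nz: "regs \<tau> 13 \<noteq> 0" for m \<tau>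
  proof -
    obtain q f where env: "env \<tau>" and \<tau>: "emitted \<tau> = emitted \<sigma>" "regs \<tau> 10 = regs \<sigma> 10"
      "regs \<tau> 7 = q" "regs \<tau> 6 = f"
      and q: "l \<le> q" "q < e" and f: "f0 \<le> f" "f \<le> mf"
      and occ: "\<forall>q'\<in>{l..<q}. occ T q' r (T ! q') \<le> f" and m: "m = 29 * ((e - q) + (mf - f))"
      using I nz unfolding I_def J_def by auto
    have fn: "f \<le> n" and qr: "q \<le> r"
      using f mf_le q e_le by linarith+
    let ?b = "f < occ T q r (T ! q)"
    let ?mid = "\<lambda>\<sigma>'. emitted \<sigma>' = emitted \<sigma> \<and> regs \<sigma>' 10 = regs \<sigma> 10 \<and> regs \<sigma>' 7 = q \<and>
      regs \<sigma>' 6 = f \<and> env \<sigma>' \<and> regs \<sigma>' 17 = f"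
    let ?mid2 = "\<lambda>\<sigma>'. emitted \<sigma>' = emitted \<sigma> \<and> regs \<sigma>' 10 = regs \<sigma> 10 \<and> regs \<sigma>' 7 = q \<and>
      regs \<sigma>' 6 = f \<and> env \<sigma>' \<and> regs \<sigma>' 13 = of_bool ?b"
    have 1: "runs w T D (Do (Arith Add 17 6 18)) \<tau> 1 ?mid"
      using env \<tau> mod_small[OF fn] by (intro runs_Do) (simp add: set_reg_def env_def)
    have 2: "runs w T D test \<sigma>1 23 ?mid2" if "?mid \<sigma>1" for \<sigma>1
      by (rule runs_mono[OF runs_test[of \<sigma>1 q f]]) (use that fn qr in \<open>auto simp: env_def\<close>)
    have 3: "runs w T D
       (straight [Arith Add 6 6 13, Arith Sub 14 11 13, Arith Add 7 7 14, Arith Less 13 7 8]) \<sigma>2 4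
       (\<lambda>\<sigma>'. \<exists>m'. I m' \<sigma>' \<and> m' + 28 + 1 \<le> m)" if mid2: "?mid2 \<sigma>2" for \<sigma>2
    proof (cases ?b)
      case True
      have "f < mf"
        using True occ_mono[of l q r r T "T ! q"] occ_le_mode_freq[of T l r "T ! q"] q by linarith
      moreover have "(f + 1) mod 2 ^ w = f + 1" "q mod 2 ^ w = q"
        using \<open>f < mf\<close> mf_le(1) qr lr by (auto intro!: mod_small)
      ultimately have "runs w T D (straight [Arith Add 6 6 13, Arith Sub 14 11 13, Arith Add 7 7 14,
          Arith Less 13 7 8]) \<sigma>2 4 (J q (f + 1))"
        using mid2 True q unfolding J_def
        by (intro runs_straightI) (simp_all add: set_reg_def env_def)
      then show ?thesis
      proof (rule runs_mono)
        fix \<sigma>' assume "J q (f + 1) \<sigma>'"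
        then have "I (29 * ((e - q) + (mf - (f + 1)))) \<sigma>'"
          unfolding I_def using q f occ \<open>f < mf\<close> le_SucI by (intro exI[of _ q] exI[of _ "f + 1"]) auto
        moreover have "29 * ((e - q) + (mf - (f + 1))) + 28 + 1 \<le> m"
          unfolding m Suc_diff_Suc[OF \<open>f < mf\<close>, symmetric] by simp
        ultimately show "\<exists>m'. I m' \<sigma>' \<and> m' + 28 + 1 \<le> m"
          by blast
      qed simp
    next
      case False
      have "(q + 1) mod 2 ^ w = q + 1" "f mod 2 ^ w = f" "1 mod 2 ^ w = (1::nat)"
        using qr lr fn by (auto intro!: mod_small)
      then have "runs w T D (straight [Arith Add 6 6 13, Arith Sub 14 11 13, Arith Add 7 7 14,
          Arith Less 13 7 8]) \<sigma>2 4 (J (q + 1) f)"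
        using mid2 False q unfolding J_def
        by (intro runs_straightI) (simp_all add: set_reg_def env_def)
      then show ?thesis
      proof (rule runs_mono)
        fix \<sigma>' assume "J (q + 1) f \<sigma>'"
        then have "I (29 * ((e - (q + 1)) + (mf - f))) \<sigma>'"
          unfolding I_def using q f occ False
          by (intro exI[of _ "q + 1"] exI[of _ f]) (auto simp: less_Suc_eq)
        moreover have "29 * ((e - (q + 1)) + (mf - f)) + 28 + 1 \<le> m"
          unfolding m Suc_diff_Suc[OF q(2), symmetric] by simp
        ultimately show "\<exists>m'. I m' \<sigma>' \<and> m' + 28 + 1 \<le> m"
          by blast
      qed simp
    qed
    show ?thesis
      by (rule runs_mono[OF runs_Seq[OF 1 runs_Seq[OF 2 3]]], assumption+, simp)
  qed
  show ?thesis
    unfolding find_mode_freq_def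
  proof (rule runs_mono[OF runs_While[of I, OF body init]])
    fix \<sigma>' assume *: "(\<exists>m'. I m' \<sigma>') \<and> regs \<sigma>' 13 = 0"
    obtain q f where J: "J q f \<sigma>'" and q: "q \<le> e" and f: "f0 \<le> f" "f \<le> mf"
      "\<forall>q'\<in>{l..<q}. occ T q' r (T ! q') \<le> f"
      using * unfolding I_def by blast
    have "of_bool (q < e) = (0::nat)"
      using * J unfolding J_def by metis
    then have "q = e"
      using q unfolding of_bool_eq_0_iff by (metis le_neq_implies_less)
    have "mf = f"
      by (rule mode_freq_eqI[OF less_imp_le[OF p_bounds(1)] f(1,2)])
        (use f(3) \<open>q = e\<close> in blast)
    then show "env \<sigma>' \<and> emitted \<sigma>' = emitted \<sigma> \<and> regs \<sigma>' 10 = regs \<sigma> 10 \<and> regs \<sigma>' 6 = mf"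
      using J unfolding J_def by blast
  qed simp_all
qed

lemma runs_rewind:
  assumes "env \<sigma>" "regs \<sigma> 6 = mf" "regs \<sigma> 10 \<le> n"
  shows "runs w T D rewind \<sigma> 5
    (\<lambda>\<sigma>'. env \<sigma>' \<and> emitted \<sigma>' = emitted \<sigma> \<and> regs \<sigma>' 7 = l \<and> regs \<sigma>' 17 = mf - 1 \<and>
       regs \<sigma>' 13 = of_bool (l < e) \<and> regs \<sigma>' 10 = (if f0 = mf then regs \<sigma> 10 else 0))"
proof -
  \<comment> \<open>Positivity of the mode frequency rules out a wrap-around to the largest
    word.\<close>
  have "(mf + 2 ^ w - Suc 0) mod 2 ^ w = mf - Suc 0"
  proof -
    have "(mf + 2 ^ w - Suc 0) mod 2 ^ w = (mf - Suc 0 + 2 ^ w) mod 2 ^ w"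
      using mf_le(4) by (simp add: Nat.add_diff_assoc2)
    then show ?thesis
      using mf_le(1) by (simp add: mod_small)
  qed
  then show ?thesis
    unfolding rewind_def using assms mod_small[of l] mod_small[of "regs \<sigma> 10"] lr
    by (intro runs_straightI) (auto simp: set_reg_def env_def)
qed

lemma runs_emit_prefix:
  assumes "env \<sigma>" "regs \<sigma> 7 = l" "regs \<sigma> 17 = mf - 1" "regs \<sigma> 13 = of_bool (l < e)" "emitted \<sigma> = []"
  shows "runs w T D emit_prefix \<sigma> (29 * (e - l) + 1)
    (\<lambda>\<sigma>'. env \<sigma>' \<and> regs \<sigma>' 10 = regs \<sigma> 10 \<and>
       emitted \<sigma>' = map ((!) T) (filter (\<lambda>q. mf \<le> occ T q r (T ! q)) [l..<e]))"
proof -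
  define em where "em q = map ((!) T) (filter (\<lambda>q. mf \<le> occ T q r (T ! q)) [l..<q])" for q
  define J where "J q \<sigma>' \<longleftrightarrow> env \<sigma>' \<and> regs \<sigma>' 10 = regs \<sigma> 10 \<and> regs \<sigma>' 17 = mf - 1 \<and>
    regs \<sigma>' 7 = q \<and> emitted \<sigma>' = em q \<and> regs \<sigma>' 13 = of_bool (q < e)" for q and \<sigma>' :: state
  define I where "I m \<sigma>' \<longleftrightarrow> (\<exists>q. J q \<sigma>' \<and> l \<le> q \<and> q \<le> e \<and> m = 29 * (e - q))" for m \<sigma>'
  have init: "I (29 * (e - l)) \<sigma>"
    unfolding I_def J_def using assms l_less_e by (intro exI[of _ l]) (auto simp: em_def)
  have body: "runs w T D (Seq test (Seq
     (If 13 (straight [ReadChar 14 7, Emit 14]) (Do (Const 14 0)))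
     (straight [Arith Add 7 7 11, Arith Less 13 7 8]))) \<tau> 28
     (\<lambda>\<sigma>'. \<exists>m'. I m' \<sigma>' \<and> m' + 28 + 1 \<le> m)" if I: "I m \<tau>" and nz: "regs \<tau> 13 \<noteq> 0" for m \<tau>
  proof -
    obtain q where env: "env \<tau>" and \<tau>: "emitted \<tau> = em q" "regs \<tau> 10 = regs \<sigma> 10"
      "regs \<tau> 7 = q" "regs \<tau> 17 = mf - 1"
      and q: "l \<le> q" "q < e" and m: "m = 29 * (e - q)"
      using I nz unfolding I_def J_def by auto
    have qr: "q \<le> r" and qn: "q < n"
      using q e_le lr by linarith+
    let ?b = "mf \<le> occ T q r (T ! q)"
    let ?mid = "\<lambda>\<sigma>' x. env \<sigma>' \<and> regs \<sigma>' 10 = regs \<sigma> 10 \<and> regs \<sigma>' 7 = q \<and> regs \<sigma>' 17 = mf - 1 \<and>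
      emitted \<sigma>' = x"
    have b: "mf - 1 < occ T q r (T ! q) \<longleftrightarrow> ?b"
      using mf_le(4) by linarith
    have 1: "runs w T D test \<tau> 23 (\<lambda>\<sigma>'. ?mid \<sigma>' (em q) \<and> regs \<sigma>' 13 = of_bool ?b)"
      by (rule runs_mono[OF runs_test[of \<tau> q "mf - 1"]])
        (use env \<tau> qr mf_le(1) b in \<open>auto simp: env_def\<close>)
    have 2: "runs w T D (If 13 (straight [ReadChar 14 7, Emit 14]) (Do (Const 14 0))) \<sigma>1 (2 + 1)
        (\<lambda>\<sigma>'. ?mid \<sigma>' (em (Suc q)))"
      if mid: "?mid \<sigma>1 (em q) \<and> regs \<sigma>1 13 = of_bool ?b" for \<sigma>1
    proof (rule runs_If)
      assume "regs \<sigma>1 13 \<noteq> 0"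
      then show "runs w T D (straight [ReadChar 14 7, Emit 14]) \<sigma>1 2 (\<lambda>\<sigma>'. ?mid \<sigma>' (em (Suc q)))"
        using mid qn q by (intro runs_straightI) (auto simp: set_reg_def env_def em_def)
    next
      assume "regs \<sigma>1 13 = 0"
      then have "runs w T D (Do (Const 14 0)) \<sigma>1 1 (\<lambda>\<sigma>'. ?mid \<sigma>' (em (Suc q)))"
        using mid qn q by (intro runs_Do) (auto simp: set_reg_def env_def em_def)
      then show "runs w T D (Do (Const 14 0)) \<sigma>1 2 (\<lambda>\<sigma>'. ?mid \<sigma>' (em (Suc q)))"
        by (rule runs_mono) simp_all
    qed
    have 3: "runs w T D (straight [Arith Add 7 7 11, Arith Less 13 7 8]) \<sigma>2 2
       (\<lambda>\<sigma>'. \<exists>m'. I m' \<sigma>' \<and> m' + 28 + 1 \<le> m)" if mid: "?mid \<sigma>2 (em (Suc q))" for \<sigma>2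
    proof -
      have "runs w T D (straight [Arith Add 7 7 11, Arith Less 13 7 8]) \<sigma>2 2 (J (Suc q))"
        using mid mod_small[of "Suc q"] qn unfolding J_def
        by (intro runs_straightI) (simp_all add: set_reg_def env_def)
      then show ?thesis
      proof (rule runs_mono)
        fix \<sigma>' assume "J (Suc q) \<sigma>'"
        then have "I (29 * (e - Suc q)) \<sigma>'"
          unfolding I_def using q by (intro exI[of _ "Suc q"]) auto
        moreover have "29 * (e - Suc q) + 28 + 1 \<le> m"
          unfolding m Suc_diff_Suc[OF q(2), symmetric] by simp
        ultimately show "\<exists>m'. I m' \<sigma>' \<and> m' + 28 + 1 \<le> m"
          by blast
      qed simp
    qed
    show ?thesis
      by (rule runs_mono[OF runs_Seq[OF 1 runs_Seq[OF 2 3]]], assumption+, simp)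
  qed
  show ?thesis
    unfolding emit_prefix_def
  proof (rule runs_mono[OF runs_While[of I, OF body init]])
    fix \<sigma>' assume "(\<exists>m'. I m' \<sigma>') \<and> regs \<sigma>' 13 = 0"
    then obtain q where q: "J q \<sigma>'" "q \<le> e" and "regs \<sigma>' 13 = 0"
      unfolding I_def by blast
    then have "of_bool (q < e) = (0::nat)"
      unfolding J_def by metis
    then have "q = e"
      using q(2) unfolding of_bool_eq_0_iff by (metis le_neq_implies_less)
    then show "env \<sigma>' \<and> regs \<sigma>' 10 = regs \<sigma> 10 \<and>
       emitted \<sigma>' = map ((!) T) (filter (\<lambda>q. mf \<le> occ T q r (T ! q)) [l..<e])"
      using q(1) unfolding J_def em_def by blast
  qed simp_all
qed

lemma runs_emit_level:
  assumes "env \<sigma>" "regs \<sigma> 10 = last_on_level T p mf (Suc r)"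
  shows "runs w T D emit_level \<sigma> (12 * length (level T p mf (Suc r)) + 1)
    (\<lambda>\<sigma>'. emitted \<sigma>' = emitted \<sigma> @ map ((!) T) (level T p mf (Suc r)))"
proof -
  \<comment> \<open>What is emitted followed by what is still to be visited never changes. Field 2
    of a record continues the right list because the current position is itself on level
    \<open>mf\<close>.\<close>
  define I where "I m \<sigma>' \<longleftrightarrow> (\<exists>b. env \<sigma>' \<and> b \<le> Suc r \<and> regs \<sigma>' 10 = last_on_level T p mf b \<and>
    emitted \<sigma>' @ map ((!) T) (level T p mf b) = emitted \<sigma> @ map ((!) T) (level T p mf (Suc r)) \<and>
    m = 12 * length (level T p mf b))" for m and \<sigma>' :: state
  have init: "I (12 * length (level T p mf (Suc r))) \<sigma>"
    unfolding I_def using assms by (intro exI[of _ "Suc r"]) auto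
  have body: "runs w T D (straight ([Arith Sub 10 10 11, ReadChar 14 10, Emit 14,
     Arith Add 19 12 10] @ fetch 10 19 2)) \<tau> 11
     (\<lambda>\<sigma>'. \<exists>m'. I m' \<sigma>' \<and> m' + 11 + 1 \<le> m)" if I: "I m \<tau>" and nz: "regs \<tau> 10 \<noteq> 0" for m \<tau>
  proof -
    obtain b where env: "env \<tau>" and b: "b \<le> Suc r" "regs \<tau> 10 = last_on_level T p mf b"
      and em: "emitted \<tau> @ map ((!) T) (level T p mf b) = emitted \<sigma> @ map ((!) T) (level T p mf (Suc r))"
      and m: "m = 12 * length (level T p mf b)"
      using I unfolding I_def by auto
    obtain v where v: "last_on_level T p mf b = Suc v"
      using nz b by (auto simp: gr0_conv_Suc)
    have vr: "v \<le> r" "v < n"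
      using last_on_level_le[of T p mf b] v b lr by linarith+
    have lev: "level T p mf b = v # level T p mf v" and occ: "occ T p v (T ! v) = mf"
      using v by (rule level_Cons, rule last_on_level_occ)
    have "(i0 * n + v) mod 2 ^ w = i0 * n + v" "v mod 2 ^ w = v"
      using row_bound[OF vr(2)] vr by (auto intro!: mod_small mod_less bound)
    then have "runs w T D (straight ([Arith Sub 10 10 11, ReadChar 14 10, Emit 14,
       Arith Add 19 12 10] @ fetch 10 19 2)) \<tau> 11
       (\<lambda>\<sigma>'. env \<sigma>' \<and> regs \<sigma>' 10 = last_on_level T p mf v \<and> emitted \<sigma>' = emitted \<tau> @ [T ! v])"
      using env b(2)[unfolded v] vr row_bound[OF vr(2)] occ
      by (intro runs_straightI)
        (simp_all add: steps_append steps_fetch env_def entry_eqs set_reg_def)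
    then show ?thesis
    proof (rule runs_mono)
      fix \<sigma>'
      assume "env \<sigma>' \<and> regs \<sigma>' 10 = last_on_level T p mf v \<and> emitted \<sigma>' = emitted \<tau> @ [T ! v]"
      then have "I (12 * length (level T p mf v)) \<sigma>'"
        using em[unfolded lev] vr unfolding I_def by (intro exI[of _ v]) simp
      then show "\<exists>m'. I m' \<sigma>' \<and> m' + 11 + 1 \<le> m"
        using m[unfolded lev] by auto
    qed simp
  qed
  show ?thesis
    unfolding emit_level_def
  proof (rule runs_mono[OF runs_While[of I, OF body init]])
    fix \<sigma>' assume "(\<exists>m'. I m' \<sigma>') \<and> regs \<sigma>' 10 = 0"
    then show "emitted \<sigma>' = emitted \<sigma> @ map ((!) T) (level T p mf (Suc r))"
      unfolding I_def by (metis append_Nil2 level_Nil list.map(1))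
  qed simp_all
qed

lemma runs_read_width:
  "runs w T D read_width (query_state l r mem0) (3 * k + 3)
    (\<lambda>\<sigma>'. regs \<sigma>' 0 = l \<and> regs \<sigma>' (Suc 0) = r \<and> regs \<sigma>' 2 = k \<and> regs \<sigma>' 11 = 1 \<and>
       regs \<sigma>' 18 = 0 \<and> emitted \<sigma>' = [])"
proof -
  define I where "I m \<sigma>' \<longleftrightarrow> (\<exists>i. regs \<sigma>' 0 = l \<and> regs \<sigma>' (Suc 0) = r \<and> regs \<sigma>' 2 = i \<and> i \<le> k \<and>
    regs \<sigma>' 11 = 1 \<and> regs \<sigma>' 18 = 0 \<and> emitted \<sigma>' = [] \<and> regs \<sigma>' 13 = of_bool (i < k) \<and>
    m = 3 * (k - i))" for m and \<sigma>' :: state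
  have one: "1 mod 2 ^ w = (1::nat)"
    using lr by (intro mod_small) simp
  have bit: "bit_field D i (Suc 0) = of_bool (i < k)" if "i \<le> k" for i
    using that by (simp add: D bit_field_encode_header)
  have 1: "runs w T D (straight [Const 11 1, ReadBits 13 2 11]) (query_state l r mem0) 2 (I (3 * k))"
    using one bit[of 0] k unfolding I_def
    by (intro runs_straightI) (auto simp: set_reg_def query_state_def length_D)
  have body: "runs w T D (straight [Arith Add 2 2 11, ReadBits 13 2 11]) \<tau> 2
     (\<lambda>\<sigma>'. \<exists>m'. I m' \<sigma>' \<and> m' + 2 + 1 \<le> m)" if I: "I m \<tau>" and nz: "regs \<tau> 13 \<noteq> 0" for m \<tau>
  proof -
    obtain i where i: "i < k" "m = 3 * (k - i)" "regs \<tau> 2 = i"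
      and \<tau>: "regs \<tau> 0 = l" "regs \<tau> (Suc 0) = r" "regs \<tau> 11 = 1" "regs \<tau> 18 = 0" "emitted \<tau> = []"
      using I nz unfolding I_def by auto
    have "Suc i mod 2 ^ w = Suc i"
      using i size length_D by (intro mod_less) linarith
    then have "runs w T D (straight [Arith Add 2 2 11, ReadBits 13 2 11]) \<tau> 2 (I (3 * (k - Suc i)))"
      using bit[of "Suc i"] k i \<tau> unfolding I_def
      by (intro runs_straightI) (auto simp: set_reg_def length_D)
    then show ?thesis
      by (rule runs_mono) (use i in auto)
  qed
  have 2: "runs w T D (While 13 (straight [Arith Add 2 2 11, ReadBits 13 2 11])) \<sigma> (3 * k + 1)
      (\<lambda>\<sigma>'. (\<exists>m'. I m' \<sigma>') \<and> regs \<sigma>' 13 = 0)" if "I (3 * k) \<sigma>" for \<sigma>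
    by (rule runs_While[of I, OF body that])
  show ?thesis
    unfolding read_width_def
    by (rule runs_mono[OF runs_Seq[OF 1 2]]) (auto simp: I_def)
qed

lemma runs_prepare:
  assumes "regs \<sigma> 0 = l" "regs \<sigma> (Suc 0) = r" "regs \<sigma> 2 = k" "regs \<sigma> 11 = 1" "regs \<sigma> 18 = 0"
  shows "runs w T D prepare \<sigma> 43
    (\<lambda>\<sigma>'. env \<sigma>' \<and> emitted \<sigma>' = emitted \<sigma> \<and> regs \<sigma>' 6 = f0 \<and> regs \<sigma>' 7 = l \<and>
       regs \<sigma>' 10 = last_on_level T p f0 (Suc r) \<and> regs \<sigma>' 13 = of_bool (l < e))"
proof -
  \<comment> \<open>The boundary may exceed \<open>n\<close> but not \<open>2 * n\<close>, so it is
    compared with the table size.\<close>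
  have p: "p mod 2 ^ w = p" "Suc i0 mod 2 ^ w = Suc i0"
  proof -
    have "p \<le> 7 * M"
      using p_bounds(2) s(2) lr n_le_M by linarith
    moreover have "(i0 + 1) * 1 \<le> p"
      using s by (intro mult_le_mono2) simp
    then have "Suc i0 \<le> p"
      by simp
    ultimately have "p \<le> 7 * M" "Suc i0 \<le> 7 * M"
      by (blast intro: le_trans)+
    then show "p mod 2 ^ w = p" "Suc i0 mod 2 ^ w = Suc i0"
      by (blast intro: mod_less bound)+
  qed
  have off: "(i0 * n) mod 2 ^ w = i0 * n" "(i0 * n + r) mod 2 ^ w = i0 * n + r"
  proof -
    have "i0 * n \<le> 7 * M" "i0 * n + r \<le> 7 * M"
      using row_bound[OF lr(2)] by linarith+
    then show "(i0 * n) mod 2 ^ w = i0 * n" "(i0 * n + r) mod 2 ^ w = i0 * n + r"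
      by (blast intro: mod_less bound)+
  qed
  have small: "i0 mod 2 ^ w = i0" "Suc r mod 2 ^ w = Suc r" "Suc k mod 2 ^ w = Suc k" "l mod 2 ^ w = l"
    "f0 mod 2 ^ w = f0" "1 mod 2 ^ w = (1::nat)"
  proof -
    have "i0 \<le> n" "Suc r \<le> n" "l \<le> n" "f0 \<le> n" "1 \<le> n"
      using div_le_dividend[of l s] lr mf_le(1,3) by linarith+
    then show "i0 mod 2 ^ w = i0" "Suc r mod 2 ^ w = Suc r" "l mod 2 ^ w = l" "f0 mod 2 ^ w = f0"
      "1 mod 2 ^ w = (1::nat)"
      by (blast intro: mod_small)+
    show "Suc k mod 2 ^ w = Suc k"
      using size length_D by (intro mod_less) linarith
  qed
  show ?thesis
    unfolding prepare_def using assms p off small row_bound[OF lr(2)] lr T_nonempty l_less_e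
    \<comment> \<open>The case distinction resolves the minimum that was computed without
      branching.\<close>
    by (cases "Suc r < p"; intro runs_straightI)
      (simp_all add: steps_append steps_fetch env_def entry_eqs entry_params set_reg_def
        del: last_on_level.simps)
qed

lemma runs_query:
  "runs w T D query (query_state l r mem0) (3 * k + 54 + 87 * s + 12 * card (range_modes T l r))
    (\<lambda>\<sigma>'. distinct (emitted \<sigma>') \<and> set (emitted \<sigma>') = range_modes T l r)"
proof -
  let ?pre = "map ((!) T) (filter (\<lambda>q. mf \<le> occ T q r (T ! q)) [l..<e])"
  let ?last = "if f0 = mf then last_on_level T p f0 (Suc r) else 0"
  define c where "c = (if f0 = mf then length (level T p mf (Suc r)) else 0)"
  define A where "A \<sigma>' \<longleftrightarrow> regs \<sigma>' 0 = l \<and> regs \<sigma>' (Suc 0) = r \<and> regs \<sigma>' 2 = k \<and> regs \<sigma>' 11 = 1 \<and>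
       regs \<sigma>' 18 = 0 \<and> emitted \<sigma>' = []" for \<sigma>' :: state
  define B where "B \<sigma>' \<longleftrightarrow> env \<sigma>' \<and> emitted \<sigma>' = [] \<and> regs \<sigma>' 6 = f0 \<and> regs \<sigma>' 7 = l \<and>
       regs \<sigma>' 10 = last_on_level T p f0 (Suc r) \<and> regs \<sigma>' 13 = of_bool (l < e)" for \<sigma>' :: state
  define C where "C \<sigma>' \<longleftrightarrow> env \<sigma>' \<and> emitted \<sigma>' = [] \<and> regs \<sigma>' 6 = mf \<and>
       regs \<sigma>' 10 = last_on_level T p f0 (Suc r)" for \<sigma>' :: state
  define E where "E \<sigma>' \<longleftrightarrow> env \<sigma>' \<and> emitted \<sigma>' = [] \<and> regs \<sigma>' 7 = l \<and> regs \<sigma>' 17 = mf - 1 \<and>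
       regs \<sigma>' 10 = ?last \<and> regs \<sigma>' 13 = of_bool (l < e)" for \<sigma>' :: state
  define F where "F \<sigma>' \<longleftrightarrow> env \<sigma>' \<and> emitted \<sigma>' = ?pre \<and> regs \<sigma>' 10 = ?last" for \<sigma>' :: state
  have 1: "runs w T D read_width (query_state l r mem0) (3 * k + 3) A"
    unfolding A_def by (rule runs_read_width)
  have 2: "runs w T D prepare \<sigma> 43 B" if "A \<sigma>" for \<sigma>
    by (rule runs_mono[OF runs_prepare]) (use that in \<open>simp_all add: A_def B_def\<close>)
  have 3: "runs w T D find_mode_freq \<sigma> (58 * s + 1) C" if "B \<sigma>" for \<sigma>
  proof (rule runs_mono[OF runs_find_mode_freq])
    \<comment> \<open>Both advances and increments are at most \<open>s\<close>, whence
      \<open>29 * 2 = 58\<close>.\<close>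
    have "mf - f0 \<le> s"
      using e_le(2) mf_le(2) by linarith
    then have "e - l + (mf - f0) \<le> s + s"
      by (rule add_mono[OF e_le(2)])
    then have "29 * (e - l + (mf - f0)) + 1 \<le> 29 * (s + s) + 1"
      by (intro add_right_mono mult_le_mono2)
    also have "29 * (s + s) + 1 = 58 * s + 1"
      by simp
    finally show "29 * (e - l + (mf - f0)) + 1 \<le> 58 * s + 1" .
  qed (use that in \<open>simp_all add: B_def C_def\<close>)
  have 4: "runs w T D rewind \<sigma> 5 E" if "C \<sigma>" for \<sigma>
  proof (rule runs_mono[OF runs_rewind])
    show "regs \<sigma> 10 \<le> n"
      using that last_on_level_le[of T p f0 "Suc r"] lr unfolding C_def by linarith
  qed (use that in \<open>simp_all add: C_def E_def\<close>)
  have 5: "runs w T D emit_prefix \<sigma> (29 * s + 1) F" if "E \<sigma>" for \<sigma>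
  proof (rule runs_mono[OF runs_emit_prefix])
    show "29 * (e - l) + 1 \<le> 29 * s + 1"
      using e_le(2) by (intro add_right_mono mult_le_mono2)
  qed (use that in \<open>simp_all add: E_def F_def\<close>)
  have 6: "runs w T D emit_level \<sigma> (12 * c + 1) (\<lambda>\<sigma>'. emitted \<sigma>' = listing T l p r)" if "F \<sigma>" for \<sigma>
  proof (cases "f0 = mf")
    case True
    then have "env \<sigma>" "regs \<sigma> 10 = last_on_level T p mf (Suc r)" "emitted \<sigma> = ?pre"
      using that unfolding F_def by (simp_all only: if_True simp_thms)
    then show ?thesis
      using runs_emit_level[of \<sigma>] True unfolding c_def listing_def by (simp only: if_True simp_thms map_append)
  next
    case False
    then have "regs \<sigma> 10 = 0" "emitted \<sigma> = ?pre"
      using that unfolding F_def by (simp_all only: if_False)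
    then show ?thesis
      using False exec.WhileFalse[of \<sigma> 10 w T D] unfolding runs_def c_def listing_def emit_level_def
      by (intro exI conjI) (assumption, simp_all)
  qed
  \<comment> \<open>List traversal is paid for by the output, since each cell yields its own
    mode.\<close>
  have c: "c \<le> card (range_modes T l r)"
  proof -
    have "c \<le> length (listing T l p r)"
      by (simp add: c_def listing_def)
    also have "\<dots> = card (range_modes T l r)"
      using listing_correct[of l r p T] p_bounds(1) lr(1) distinct_card[of "listing T l p r"] by simp
    finally show ?thesis .
  qed
  have "runs w T D query (query_state l r mem0)
    (3 * k + 3 + (43 + (58 * s + 1 + (5 + (29 * s + 1 + (12 * c + 1))))))
    (\<lambda>\<sigma>'. emitted \<sigma>' = listing T l p r)"
    unfolding query_def by (intro runs_Seq[OF 1] runs_Seq[OF 2] runs_Seq[OF 3] runs_Seq[OF 4] runs_Seq[OF 5] 6)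
  then show ?thesis
  proof (rule runs_mono)
    fix \<sigma>' assume "emitted \<sigma>' = listing T l p r"
    then show "distinct (emitted \<sigma>') \<and> set (emitted \<sigma>') = range_modes T l r"
      using listing_correct[of l r p T] p_bounds(1) lr(1) by simp
  qed (use c in linarith)
qed

end

section \<open>Parameters\<close>

text \<open>Apply \<open>ln x \<le> x - 1\<close> to the square root and use
  \<open>ln 2 \<ge> 1/2\<close>. This absorbs the time for decoding the header.\<close>

lemma log2_le_sqrt: "0 < n \<Longrightarrow> log 2 (real n) \<le> 4 * sqrt (real n)"
proof -
  assume n: "0 < n"
  have "ln (sqrt (real n)) \<le> sqrt (real n) - 1"
    using n by (intro ln_le_minus_one) simp
  then have "ln (real n) \<le> 2 * sqrt (real n)"
    using n by (simp add: ln_sqrt)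
  moreover have "1 / 2 \<le> ln (2 :: real)"
  proof -
    have "1 \<le> ln (4 :: real)"
      using exp_le by (simp add: ln_ge_iff)
    also have "ln (4 :: real) = ln (2 ^ 2)" by simp
    also have "\<dots> = 2 * ln 2" by (subst ln_realpow) auto
    finally show ?thesis by simp
  qed
  then have "4 * sqrt (real n) * (1 / 2) \<le> 4 * sqrt (real n) * ln 2"
    by (intro mult_left_mono) auto
  ultimately show ?thesis
    by (simp add: log_def divide_le_eq)
qed

lemma max_freq_pos: "S \<noteq> [] \<Longrightarrow> 0 < max_freq S"
proof -
  assume "S \<noteq> []"
  then have "count (mset S) (hd S) \<le> max_freq S" "0 < count (mset S) (hd S)"
    unfolding max_freq_def by (auto intro!: Max_ge simp: count_mset_gt_0)
  then show ?thesis by linarith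
qed

lemma finite_range_modes: "finite (range_modes S l r)"
  by (rule finite_subset[of _ "set_mset (range_mset S l r)"]) (auto simp: range_modes_def is_mode_def)

text \<open>The strict bound leaves room for the entry value \<open>n\<close> itself.\<close>

lemma header_width:
  assumes "0 < n"
  obtains k where "0 < k" "n < 2 ^ k" "real k \<le> log 2 (real n) + 1"
proof -
  obtain j where j: "2 ^ j \<le> n" "n < 2 ^ (j + 1)"
    using ex_power_ivl1[of 2 n] assms by auto
  then have "(2::real) ^ j \<le> real n"
    by (metis of_nat_le_iff of_nat_numeral of_nat_power)
  then have "real j \<le> log 2 (real n)"
    by (intro le_log_of_power) auto
  with j show ?thesis
    by (intro that[of "j + 1"]) auto
qed

lemma length_encode_table:
  "length (encode k (table T s)) = Suc k + 7 * (rows T s * length T) * k"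
  by (simp add: length_encode table_def)

text \<open>With \<open>N = 2 ^ k\<close> the length is at most \<open>8 * N ^ 3\<close>, hence at
  most \<open>N ^ 6\<close> as \<open>N \<ge> 2\<close>.\<close>

lemma length_encode_less:
  assumes "length T < 2 ^ k" "0 < k" "10 * k \<le> w"
  shows "length (encode k (table T s)) < 2 ^ w"
proof -
  define N :: nat where "N = 2 ^ k"
  have N: "k < N" "length T < N" "2 \<le> N"
    using assms by (auto simp: N_def Suc_le_eq self_le_power)
  have "rows T s \<le> N"
    using N(2) div_le_dividend[of "length T" s] unfolding rows_def by linarith
  then have "rows T s * length T * k \<le> N * N * N"
    using N by (intro mult_le_mono) auto
  moreover have "N * 1 * 1 \<le> N * N * N"
    using N by (intro mult_le_mono) auto
  moreover have "2 * 2 * 2 * (N * N * N) \<le> N * N * N * (N * N * N)"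
    using N by (intro mult_le_mono) auto
  ultimately have "length (encode k (table T s)) \<le> N * N * N * (N * N * N)"
    using N(1) unfolding length_encode_table mult.assoc[of 7] by linarith
  also have "\<dots> = N ^ 6"
    by (simp add: eval_nat_numeral)
  also have "\<dots> < N ^ 10"
    using N by (intro power_strict_increasing) auto
  also have "\<dots> = 2 ^ (10 * k)"
    by (simp add: N_def power_mult mult.commute flip: power_mult)
  also have "\<dots> \<le> 2 ^ w"
    using assms by (intro power_increasing) auto
  finally show ?thesis .
qed

section \<open>Choice of the block length and the final bounds\<close>

theorem theorem20:
  fixes \<epsilon> :: real
  assumes "0 \<le> \<epsilon>" and "\<epsilon> \<le> 1 / 2"
  shows "\<exists>(P :: com) (C\<^sub>S :: real) (C\<^sub>T :: real) (c :: real). 1 \<le> c \<and>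
    (\<forall>(w :: nat) (\<Sigma> :: nat set) (code :: nat \<Rightarrow> nat) (S :: nat list) (n :: nat).
       bij_betw code \<Sigma> {..<card \<Sigma>} \<and> set S \<subseteq> \<Sigma> \<and> length S = n \<and>
       c * (log 2 (real n) + 1) \<le> real w \<and> card \<Sigma> \<le> 2 ^ w \<longrightarrow>
       (\<exists>D :: bool list.
          real (length D) \<le> C\<^sub>S * (real n powr (1 + \<epsilon>) * log 2 (real n) + real n powr (2 - \<epsilon>)) \<and>
          (\<forall>l r. l \<le> r \<and> r < n \<longrightarrow>
             enumerates_within w (map code S) D P l r (code ` range_modes S l r)
               (C\<^sub>T * (log 2 (real (max_freq S)) + real n powr (1 - \<epsilon>)
                      + real (card (range_modes S l r)))))))"
proof -
  have main: "\<exists>D :: bool list.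
          real (length D) \<le> 16 * (real n powr (1 + \<epsilon>) * log 2 (real n) + real n powr (2 - \<epsilon>)) \<and>
          (\<forall>l r. l \<le> r \<and> r < n \<longrightarrow>
             enumerates_within w (map code S) D query l r (code ` range_modes S l r)
               (250 * (log 2 (real (max_freq S)) + real n powr (1 - \<epsilon>)
                      + real (card (range_modes S l r)))))"
    if code: "bij_betw code \<Sigma> {..<card \<Sigma>}" and S: "set S \<subseteq> \<Sigma>" "length S = n"
      and w: "10 * (log 2 (real n) + 1) \<le> real w" and card: "card \<Sigma> \<le> 2 ^ w"
    for w n :: nat and \<Sigma> :: "nat set" and code :: "nat \<Rightarrow> nat" and S :: "nat list"
  proof (cases "n = 0")
    case True
    then show ?thesis by (intro exI[of _ "[]"]) simp
  next
    case False
    let ?T = "map code S"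
    define L where "L = log 2 (real n)"
    define X where "X = real n powr (1 + \<epsilon>)"
    define Y where "Y = real n powr (2 - \<epsilon>)"
    define Z where "Z = real n powr (1 - \<epsilon>)"
    from False have n: "1 \<le> real n" "0 < n" by auto
    obtain k where width: "0 < k" "n < 2 ^ k" "real k \<le> L + 1"
      using header_width[OF n(2)] unfolding L_def by metis
    have w': "10 * k \<le> w"
    proof -
      have "real (10 * k) \<le> real w"
        using w width(3) unfolding L_def by simp
      then show ?thesis by (simp only: of_nat_le_iff)
    qed
    have L: "0 \<le> L" using n unfolding L_def by simp
    \<comment> \<open>\<open>X \<le> Y\<close> is where \<open>\<epsilon> \<le> 1/2\<close> enters
      the space bound: \<open>Y\<close> pays for the terms without a logarithm.\<close>
    have XY: "1 \<le> X" "X \<le> Y"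
      using n assms unfolding X_def Y_def by (auto intro: ge_one_powr_ge_zero powr_mono)
    have Z: "1 \<le> Z" "Z \<le> real n" "sqrt (real n) \<le> Z"
      using n assms powr_mono[of "1 - \<epsilon>" 1 "real n"] powr_mono[of "1 / 2" "1 - \<epsilon>" "real n"]
      unfolding Z_def by (auto simp: powr_half_sqrt intro: ge_one_powr_ge_zero)
    \<comment> \<open>The block length is the scan time allowed; it leaves at most
      \<open>2 * n powr \<epsilon>\<close> rows.\<close>
    define s where "s = nat \<lceil>Z\<rceil>"
    have block: "0 < s" "Z \<le> real s" "real s \<le> Z + 1" "s \<le> n"
      using Z unfolding s_def by linarith+
    define D where "D = encode k (table ?T s)"
    have rows: "real (rows ?T s) \<le> 2 * real n powr \<epsilon>"
    proof -
      have "real (n div s) \<le> real n / real s"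
        by (rule of_nat_div_le_of_nat)
      also have "\<dots> \<le> real n / Z"
        using block Z n by (intro divide_left_mono mult_pos_pos) auto
      also have "\<dots> = real n powr \<epsilon>"
        using n by (simp add: Z_def powr_diff)
      finally show ?thesis
        using n assms ge_one_powr_ge_zero[of "real n" \<epsilon>] S by (simp add: rows_def)
    qed
    have M: "real (rows ?T s * n) \<le> 2 * X"
    proof -
      have "real (rows ?T s * n) \<le> 2 * real n powr \<epsilon> * real n"
        using rows by (simp add: mult_right_mono)
      also have "\<dots> = 2 * X"
        using n by (simp add: X_def powr_add)
      finally show ?thesis .
    qed
    have space: "real (length D) \<le> 16 * (X * L + Y)"
    proof -
      have "real (length D) = 1 + real k + 7 * real (rows ?T s * n) * real k"
        using S by (simp add: D_def length_encode_table)
      also have "\<dots> \<le> 1 + (L + 1) + 7 * (2 * X) * (L + 1)"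
        using M width(3) XY L by (intro add_mono mult_mono) auto
      also have "\<dots> = (L + 2) + 14 * (X * L) + 14 * X"
        by (simp add: algebra_simps)
      also have "\<dots> \<le> (X * L + 2 * X) + 14 * (X * L) + 14 * X"
      proof -
        have "1 * L \<le> X * L"
          using XY L by (intro mult_right_mono)
        then show ?thesis using XY by linarith
      qed
      also have "\<dots> \<le> 16 * (X * L + Y)"
      proof -
        have "0 \<le> X * L"
          using XY L by simp
        then show ?thesis using XY by argo
      qed
      finally show ?thesis .
    qed
    have "enumerates_within w ?T D query l r (code ` range_modes S l r)
        (250 * (log 2 (real (max_freq S)) + Z + real (card (range_modes S l r))))"
      if lr: "l \<le> r" "r < n" for l r
    proof -
      have modes: "range_modes ?T l r = code ` range_modes S l r"
        using code S lr by (intro range_modes_map[of code \<Sigma>]) (auto simp: bij_betw_def)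
      interpret mode_structure w k s l r ?T D
        using width block w' S lr length_encode_less[of ?T k w s]
        by unfold_locales (auto simp: D_def)
      let ?A = "range_modes S l r"
      have "card (range_modes ?T l r) \<le> card ?A"
        unfolding modes by (intro card_image_le finite_range_modes)
      then have "real (3 * k + 54 + 87 * s + 12 * card (range_modes ?T l r))
          \<le> 3 * (L + 1) + 54 + 87 * (Z + 1) + 12 * real (card ?A)"
        using width(3) block(3) by simp
      \<comment> \<open>\<open>L \<le> 4 * sqrt n \<le> 4 * Z\<close> and \<open>1 \<le> Z\<close>
        give at most \<open>243 * Z\<close> besides the output term.\<close>
      also have "\<dots> \<le> 250 * (Z + real (card ?A))"
        using log2_le_sqrt[OF n(2)] Z unfolding L_def by simp
      also have "\<dots> \<le> 250 * (log 2 (real (max_freq S)) + Z + real (card ?A))"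
      proof -
        have "1 \<le> real (max_freq S)"
          using max_freq_pos[of S] S lr by fastforce
        then have "0 \<le> log 2 (real (max_freq S))"
          by simp
        then show ?thesis by simp
      qed
      finally have time: "real (3 * k + 54 + 87 * s + 12 * card (range_modes ?T l r))
          \<le> 250 * (log 2 (real (max_freq S)) + Z + real (card ?A))" .
      show ?thesis
        unfolding enumerates_within_def
      proof (intro allI impI)
        fix mem0 :: "nat \<Rightarrow> nat"
        obtain t s' where run: "exec w ?T D query (query_state l r mem0) t s'"
          "t \<le> 3 * k + 54 + 87 * s + 12 * card (range_modes ?T l r)"
          "distinct (emitted s')" "set (emitted s') = range_modes ?T l r"
          using runs_query[of mem0] unfolding runs_def by (elim exE conjE) (rule that)
        have "real t \<le> 250 * (log 2 (real (max_freq S)) + Z + real (card ?A))"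
          by (rule order_trans[OF _ time]) (use run(2) in \<open>simp only: of_nat_le_iff\<close>)
        then show "\<exists>t s'. exec w ?T D query (query_state l r mem0) t s' \<and>
            real t \<le> 250 * (log 2 (real (max_freq S)) + Z + real (card ?A)) \<and>
            distinct (emitted s') \<and> set (emitted s') = code ` ?A"
          using run(1,3,4) unfolding modes by (intro exI conjI)
      qed
    qed
    then show ?thesis
      using space unfolding X_def Y_def Z_def L_def by (intro exI[of _ D] conjI allI impI) auto
  qed
  show ?thesis
    by (intro exI[of _ query] exI[of _ "16 :: real"] exI[of _ "250 :: real"] exI[of _ "10 :: real"] conjI allI impI)
      (simp, elim conjE, rule main)
qed

end
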